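(* In the online setting, where the characters of a text $T$ over a constant-size alphabet $\Sigma$ arrive one at a time and, after reading the first $n$ characters, the implicit suffix tree of $T[1\ldots n]$ with suffix links, Weiner links and the Breslauer–Italiano implicit-node structure has been maintained, the \textsc{all-nf} problem can be solved in worst-case $\mathcal{O}(n)$ time: one can report, for every string of positive net frequency in $T[1\ldots n]$, one occurrence of it together with its net frequency, in $\mathcal{O}(n)$ worst-case time.
   Context: $T[i\ldots j]$ denotes a substring; for the current text $T[1\ldots n]$, $f(P)$ is the number of occurrences of a string $P$. An occurrence $(i,j)$ is a net occurrence if $f(T[i\ldots j])\ge 2$, $f(T[i-1\ldots j])=1$ and $f(T[i\ldots j+1])=1$, where the second condition is considered true when $i=1$ and the third when $j=n$; the net frequency of a string $S$ is the number of net occurrences $(i,j)$ with $T[i\ldots j]=S$. The implicit suffix tree of $T[1\ldots n]$ is the compacted trie of all its suffixes (no sentinel), keeping explicit only the root, nodes with at least two children, and leaves. Suffix links point from a node with label $xP$ ($x\in\Sigma$) to the node with label $P$; Weiner links are their reverses. By Ukkonen's algorithm extended by Breslauer and Italiano, this tree together with suffix and Weiner links can be maintained in $\mathcal{O}(n)$ total amortized time, and a query returning the implicit nodes (loci whose strings are suffixes occurring at least twice) within a given edge takes worst-case $\mathcal{O}(1)$ time. *)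

theory Defs
  imports Main "HOL-Library.Sublist"
begin

section \<open>Net frequency\<close>

text \<open>Characters are natural numbers; the alphabet of size \<open>\<sigma>\<close> is \<open>{0..<\<sigma>}\<close>.
  Positions in a text are 1-based, and \<open>substr T i j\<close> is \<open>T[i..j]\<close> with both ends included.\<close>

definition substr :: "nat list \<Rightarrow> nat \<Rightarrow> nat \<Rightarrow> nat list" where
  "substr T i j = take (j + 1 - i) (drop (i - 1) T)"

definition freq :: "nat list \<Rightarrow> nat list \<Rightarrow> nat" where
  "freq T P = card {i. 1 \<le> i \<and> i + length P \<le> length T + 1 \<and> substr T i (i + length P - 1) = P}"

definition net_occurrence :: "nat list \<Rightarrow> nat \<Rightarrow> nat \<Rightarrow> bool" where
  "net_occurrence T i j \<longleftrightarrow>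
     1 \<le> i \<and> i \<le> j \<and> j \<le> length T \<and>
     freq T (substr T i j) \<ge> 2 \<and>
     (i = 1 \<or> freq T (substr T (i - 1) j) = 1) \<and>
     (j = length T \<or> freq T (substr T i (j + 1)) = 1)"

definition net_freq :: "nat list \<Rightarrow> nat list \<Rightarrow> nat" where
  "net_freq T S = card {(i, j). net_occurrence T i j \<and> substr T i j = S}"

text \<open>A correct output for ALL-NF: exactly one triple \<open>(i, j, \<phi>)\<close> for every string \<open>S\<close> of positive
  net frequency, where \<open>S = T[i..j]\<close> and \<open>\<phi>\<close> is the net frequency of \<open>S\<close>.\<close>

definition all_nf_output :: "nat list \<Rightarrow> (nat \<times> nat \<times> nat) list \<Rightarrow> bool" where
  "all_nf_output T out \<longleftrightarrow>
     distinct (map (\<lambda>(i, j, \<phi>). substr T i j) out) \<and>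
     (\<lambda>(i, j, \<phi>). substr T i j) ` set out = {S. net_freq T S > 0} \<and>
     (\<forall>(i, j, \<phi>) \<in> set out. 1 \<le> i \<and> i \<le> j \<and> j \<le> length T \<and> \<phi> = net_freq T (substr T i j))"


section \<open>The implicit suffix tree\<close>

text \<open>Loci are identified with the strings that they spell. The uncompacted trie has as its nodes the
  prefixes of suffixes; compaction keeps the root, the branching nodes and the leaves.\<close>

definition trie_nodes :: "nat list \<Rightarrow> nat list set" where
  "trie_nodes T = {P. \<exists>S. suffix S T \<and> prefix P S}"

definition trie_children :: "nat list \<Rightarrow> nat list \<Rightarrow> nat set" where
  "trie_children T P = {c. P @ [c] \<in> trie_nodes T}"

definition ist_nodes :: "nat list \<Rightarrow> nat list set" where
  "ist_nodes T = {P \<in> trie_nodes T.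
     P = [] \<or> card (trie_children T P) \<ge> 2 \<or> trie_children T P = {}}"

definition ist_edge :: "nat list \<Rightarrow> nat list \<Rightarrow> nat list \<Rightarrow> bool" where
  "ist_edge T U V \<longleftrightarrow>
     U \<in> ist_nodes T \<and> V \<in> ist_nodes T \<and> strict_prefix U V \<and>
     \<not> (\<exists>W \<in> ist_nodes T. strict_prefix U W \<and> strict_prefix W V)"

definition implicit_nodes :: "nat list \<Rightarrow> nat list \<Rightarrow> nat list \<Rightarrow> nat list set" where
  "implicit_nodes T U V =
     {P. strict_prefix U P \<and> strict_prefix P V \<and> suffix P T \<and> freq T P \<ge> 2}"

definition implicit_offsets :: "nat list \<Rightarrow> nat list \<Rightarrow> nat list \<Rightarrow> nat set" where
  "implicit_offsets T U V = (\<lambda>P. length P - length U) ` implicit_nodes T U V"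


section \<open>The maintained data structure\<close>

text \<open>The stored text and tree as seen by a query. Nodes have the addresses \<open>1..ist_size\<close>; the
  address 0 is the null pointer. An edge is addressed by its lower end. The label of the edge that
  enters \<open>v\<close> is given by the positions \<open>label_start v\<close> and \<open>label_end v\<close> in the text. The
  implicit-node query on that edge returns the list of its implicit nodes, i.e. \<open>imp_count v\<close> offsets
  \<open>imp_offset v 0, imp_offset v 1, ...\<close> below the upper end. (Several implicit nodes on one edge form
  an arithmetic progression, which is why a constant-time answer gives access to all of them.)\<close>

record ist =
  text_len :: nat
  text_char :: "nat \<Rightarrow> nat"
  ist_size :: nat
  ist_root :: nat
  child :: "nat \<Rightarrow> nat \<Rightarrow> nat"
  label_start :: "nat \<Rightarrow> nat"
  label_end :: "nat \<Rightarrow> nat"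
  suffix_link :: "nat \<Rightarrow> nat"
  weiner_link :: "nat \<Rightarrow> nat \<Rightarrow> nat"
  imp_count :: "nat \<Rightarrow> nat"
  imp_offset :: "nat \<Rightarrow> nat \<Rightarrow> nat"

text \<open>\<open>lab\<close> maps addresses to the strings of the nodes. \<open>points_to lab N Q a\<close>: the address \<open>a\<close> is that
  of a node whose string satisfies \<open>Q\<close>, and it is null if there is no such node. In all uses below
  at most one node satisfies \<open>Q\<close>.\<close>

definition points_to :: "(nat \<Rightarrow> nat list) \<Rightarrow> nat \<Rightarrow> (nat list \<Rightarrow> bool) \<Rightarrow> nat \<Rightarrow> bool" where
  "points_to lab N Q a \<longleftrightarrow>
     (if \<exists>v \<in> {1..N}. Q (lab v) then a \<in> {1..N} \<and> Q (lab a) else a = 0)"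

text \<open>Nothing is assumed about the order of the addresses, nor about the value of a field at
  arguments that are not addresses of nodes or edges or not characters of the alphabet.\<close>

definition represents_ist :: "nat \<Rightarrow> nat list \<Rightarrow> ist \<Rightarrow> bool" where
  "represents_ist \<sigma> T D \<longleftrightarrow>
     text_len D = length T \<and>
     (\<forall>i \<in> {1..length T}. text_char D i = T ! (i - 1)) \<and>
     (\<exists>lab.
        bij_betw lab {1..ist_size D} (ist_nodes T) \<and>
        points_to lab (ist_size D) (\<lambda>P. P = []) (ist_root D) \<and>
        (\<forall>v \<in> {1..ist_size D}.
           (\<forall>c < \<sigma>. points_to lab (ist_size D)
                (\<lambda>V. ist_edge T (lab v) V \<and> V ! length (lab v) = c) (child D v c)) \<and>
           points_to lab (ist_size D) (\<lambda>P. \<exists>x. lab v = x # P) (suffix_link D v) \<and>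
           (\<forall>x < \<sigma>. points_to lab (ist_size D) (\<lambda>P. P = x # lab v) (weiner_link D v x)) \<and>
           (\<forall>U. ist_edge T U (lab v) \<longrightarrow>
              1 \<le> label_start D v \<and> label_start D v \<le> label_end D v \<and> label_end D v \<le> length T \<and>
              U @ substr T (label_start D v) (label_end D v) = lab v \<and>
              map (imp_offset D v) [0..<imp_count D v]
                = sorted_list_of_set (implicit_offsets T U (lab v)))))"


section \<open>The machine model\<close>

text \<open>A word RAM programmed in a structured language. A program reads the data structure through
  unit-cost operations and cannot modify it; its own working memory consists of finitely many
  registers and arrays. The only arithmetic is addition and truncated subtraction.\<close>

datatype exp =
    Const nat
  | Reg nat
  | Arr nat exp
  | Add exp exp
  | Sub exp exp
  | TextLen
  | TextChar exp
  | IstSize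
  | IstRoot
  | Child exp exp
  | LabelStart exp
  | LabelEnd exp
  | SuffixLink exp
  | WeinerLink exp exp
  | ImpCount exp
  | ImpOffset exp exp

datatype test = Less exp exp | Eq exp exp | Neg test | Conj test test

datatype com =
    Skip
  | Assign nat exp
  | Store nat exp exp
  | Emit exp exp exp
  | Seq com com
  | Cond test com com
  | While test com

record state =
  regs :: "nat \<Rightarrow> nat"
  arrs :: "nat \<Rightarrow> nat \<Rightarrow> nat"
  emitted :: "(nat \<times> nat \<times> nat) list"

primrec eval_exp :: "ist \<Rightarrow> state \<Rightarrow> exp \<Rightarrow> nat" where
  "eval_exp D s (Const k) = k"
| "eval_exp D s (Reg x) = regs s x"
| "eval_exp D s (Arr a e) = arrs s a (eval_exp D s e)"
| "eval_exp D s (Add e1 e2) = eval_exp D s e1 + eval_exp D s e2"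
| "eval_exp D s (Sub e1 e2) = eval_exp D s e1 - eval_exp D s e2"
| "eval_exp D s TextLen = text_len D"
| "eval_exp D s (TextChar e) = text_char D (eval_exp D s e)"
| "eval_exp D s IstSize = ist_size D"
| "eval_exp D s IstRoot = ist_root D"
| "eval_exp D s (Child e1 e2) = child D (eval_exp D s e1) (eval_exp D s e2)"
| "eval_exp D s (LabelStart e) = label_start D (eval_exp D s e)"
| "eval_exp D s (LabelEnd e) = label_end D (eval_exp D s e)"
| "eval_exp D s (SuffixLink e) = suffix_link D (eval_exp D s e)"
| "eval_exp D s (WeinerLink e1 e2) = weiner_link D (eval_exp D s e1) (eval_exp D s e2)"
| "eval_exp D s (ImpCount e) = imp_count D (eval_exp D s e)"
| "eval_exp D s (ImpOffset e1 e2) = imp_offset D (eval_exp D s e1) (eval_exp D s e2)"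

primrec eval_test :: "ist \<Rightarrow> state \<Rightarrow> test \<Rightarrow> bool" where
  "eval_test D s (Less e1 e2) \<longleftrightarrow> eval_exp D s e1 < eval_exp D s e2"
| "eval_test D s (Eq e1 e2) \<longleftrightarrow> eval_exp D s e1 = eval_exp D s e2"
| "eval_test D s (Neg b) \<longleftrightarrow> \<not> eval_test D s b"
| "eval_test D s (Conj b1 b2) \<longleftrightarrow> eval_test D s b1 \<and> eval_test D s b2"

primrec exp_cost :: "exp \<Rightarrow> nat" where
  "exp_cost (Const k) = 1"
| "exp_cost (Reg x) = 1"
| "exp_cost (Arr a e) = 1 + exp_cost e"
| "exp_cost (Add e1 e2) = 1 + exp_cost e1 + exp_cost e2"
| "exp_cost (Sub e1 e2) = 1 + exp_cost e1 + exp_cost e2"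
| "exp_cost TextLen = 1"
| "exp_cost (TextChar e) = 1 + exp_cost e"
| "exp_cost IstSize = 1"
| "exp_cost IstRoot = 1"
| "exp_cost (Child e1 e2) = 1 + exp_cost e1 + exp_cost e2"
| "exp_cost (LabelStart e) = 1 + exp_cost e"
| "exp_cost (LabelEnd e) = 1 + exp_cost e"
| "exp_cost (SuffixLink e) = 1 + exp_cost e"
| "exp_cost (WeinerLink e1 e2) = 1 + exp_cost e1 + exp_cost e2"
| "exp_cost (ImpCount e) = 1 + exp_cost e"
| "exp_cost (ImpOffset e1 e2) = 1 + exp_cost e1 + exp_cost e2"

primrec test_cost :: "test \<Rightarrow> nat" where
  "test_cost (Less e1 e2) = 1 + exp_cost e1 + exp_cost e2"
| "test_cost (Eq e1 e2) = 1 + exp_cost e1 + exp_cost e2"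
| "test_cost (Neg b) = 1 + test_cost b"
| "test_cost (Conj b1 b2) = 1 + test_cost b1 + test_cost b2"

text \<open>\<open>exec W D c s t s'\<close>: started in \<open>s\<close>, the program \<open>c\<close> terminates in \<open>s'\<close> after exactly \<open>t\<close>
  operations. Execution is deterministic. Everything written to memory, and every array index
  written to, must be at most \<open>W\<close>; otherwise the program is stuck. With \<open>W\<close> linear in the text length
  this enforces words of logarithmic size: intermediate values of an expression of a fixed program
  exceed the values that it reads at most by a constant factor.\<close>

inductive exec :: "nat \<Rightarrow> ist \<Rightarrow> com \<Rightarrow> state \<Rightarrow> nat \<Rightarrow> state \<Rightarrow> bool"
  for W :: nat and D :: ist where
  skip: "exec W D Skip s 1 s"
| assign: "eval_exp D s e \<le> W \<Longrightarrow>
    exec W D (Assign x e) s (1 + exp_cost e) (s\<lparr>regs := (regs s)(x := eval_exp D s e)\<rparr>)"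
| store: "eval_exp D s e1 \<le> W \<Longrightarrow> eval_exp D s e2 \<le> W \<Longrightarrow>
    exec W D (Store a e1 e2) s (1 + exp_cost e1 + exp_cost e2)
      (s\<lparr>arrs := (arrs s)(a := (arrs s a)(eval_exp D s e1 := eval_exp D s e2))\<rparr>)"
| emit: "exec W D (Emit e1 e2 e3) s (1 + exp_cost e1 + exp_cost e2 + exp_cost e3)
      (s\<lparr>emitted := emitted s @ [(eval_exp D s e1, eval_exp D s e2, eval_exp D s e3)]\<rparr>)"
| seq: "exec W D c1 s t1 s1 \<Longrightarrow> exec W D c2 s1 t2 s2 \<Longrightarrow>
    exec W D (Seq c1 c2) s (t1 + t2) s2"
| cond_true: "eval_test D s b \<Longrightarrow> exec W D c1 s t s1 \<Longrightarrow>
    exec W D (Cond b c1 c2) s (1 + test_cost b + t) s1"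
| cond_false: "\<not> eval_test D s b \<Longrightarrow> exec W D c2 s t s1 \<Longrightarrow>
    exec W D (Cond b c1 c2) s (1 + test_cost b + t) s1"
| while_false: "\<not> eval_test D s b \<Longrightarrow>
    exec W D (While b c) s (1 + test_cost b) s"
| while_true: "eval_test D s b \<Longrightarrow> exec W D c s t1 s1 \<Longrightarrow> exec W D (While b c) s1 t2 s2 \<Longrightarrow>
    exec W D (While b c) s (1 + test_cost b + t1 + t2) s2"

text \<open>The working memory of a query may initially hold arbitrary garbage, for instance what earlier
  queries left behind; only the output starts empty.\<close>

definition solves_all_nf_within :: "nat \<Rightarrow> nat \<Rightarrow> com \<Rightarrow> nat list \<Rightarrow> ist \<Rightarrow> bool" where
  "solves_all_nf_within W m p T D \<longleftrightarrow>
     (\<forall>s. emitted s = [] \<longrightarrow>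
        (\<exists>t s'. exec W D p s t s' \<and> t \<le> m \<and> all_nf_output T (emitted s')))"

end

theory Submission
  imports Defs
begin

text \<open>Let \<open>L k\<close> be the length of the longest repeated prefix of the suffix that starts at \<open>k\<close>. The net
  occurrences are exactly the intervals of length \<open>L k > 0\<close> from \<open>k\<close> with \<open>k\<close> first or
  \<open>L (k - 1) \<le> L k\<close>, so there is at most one for each \<open>k\<close>. If the suffix is a leaf, then \<open>L k\<close> is the
  depth of the lowest implicit node on the edge into the leaf, or of the parent if there is none; and
  suffix links lead from the leaf of the whole text through all leaves, in the order of \<open>k\<close>, and then to
  the longest repeated suffix. Shorter suffixes start no net occurrence, since there
  \<open>L (k - 1) = L k + 1\<close>.

  It remains to count equal strings. A string of positive net frequency that is not a node can only be
  the longest repeated suffix: it continues in one way only, so all its occurrences but one are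
  suffixes, and if it is not the longest repeated one, then the remaining occurrence extends
  to the left by a repeated string. Hence one counter per node and a further one suffice.\<close>

subsection \<open>Occurrences\<close>

text \<open>Starts are counted from 0 here and from 1 in \<open>freq\<close>. Admitting
  \<open>k = length T\<close> gives the empty string \<open>length T + 1\<close> occurrences, as
  under \<open>freq\<close>.\<close>

definition occs :: "nat list \<Rightarrow> nat list \<Rightarrow> nat set" where
  "occs T P = {k. k \<le> length T \<and> prefix P (drop k T)}"

lemma prefix_iff_take: "prefix P xs \<longleftrightarrow> take (length P) xs = P"
  by (metis append_eq_conv_conj prefix_def take_is_prefix)

lemma finite_occs [simp]: "finite (occs T P)"
  unfolding occs_def by (rule finite_subset[of _ "{..length T}"]) auto

lemma substr_Suc: "substr T (Suc k) (k + l) = take l (drop k T)"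
  by (simp add: substr_def)

lemma freq_eq_card_occs: "freq T P = card (occs T P)"
proof -
  have "{i. 1 \<le> i \<and> i + length P \<le> length T + 1 \<and> substr T i (i + length P - 1) = P}
      = Suc ` occs T P" (is "?A = _")
  proof (intro set_eqI iffI)
    fix i assume i: "i \<in> ?A"
    then obtain k where k: "i = Suc k" by (cases i) auto
    with i have "k \<in> occs T P"
      by (auto simp: occs_def substr_Suc prefix_iff_take)
    with k show "i \<in> Suc ` occs T P" by blast
  next
    fix i assume "i \<in> Suc ` occs T P"
    then obtain k where k: "i = Suc k" "k \<in> occs T P" by auto
    then have "length P \<le> length T - k"
      unfolding occs_def using prefix_length_le by fastforce
    with k show "i \<in> ?A"
      by (auto simp: occs_def substr_Suc prefix_iff_take)
  qed
  then show ?thesis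
    unfolding freq_def by (simp add: card_image)
qed

definition repeated :: "nat list \<Rightarrow> nat list \<Rightarrow> bool" where
  "repeated T P \<longleftrightarrow> freq T P \<ge> 2"

lemma repeatedI: "i \<in> occs T P \<Longrightarrow> j \<in> occs T P \<Longrightarrow> i \<noteq> j \<Longrightarrow> repeated T P"
  unfolding repeated_def freq_eq_card_occs
  using card_mono[of "occs T P" "{i, j}"] by simp

lemma repeatedE:
  assumes "repeated T P"
  obtains j where "j \<in> occs T P" "j \<noteq> i"
proof -
  have "\<not> occs T P \<subseteq> {i}"
    using assms card_mono[of "{i}" "occs T P"]
    unfolding repeated_def freq_eq_card_occs by auto
  then show thesis using that by blast
qed

text \<open>A string that occurs has positive frequency. So the conditions \<open>= 1\<close> on net
  occurrences become negations of \<open>repeated\<close>, a property that passes to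
  prefixes.\<close>

lemma freq_eq_1_iff:
  assumes "k \<in> occs T P"
  shows "freq T P = 1 \<longleftrightarrow> \<not> repeated T P"
proof -
  have "card (occs T P) > 0"
    using assms by (auto simp: card_gt_0_iff)
  then show ?thesis
    by (auto simp: repeated_def freq_eq_card_occs)
qed

lemma repeated_Nil: "T \<noteq> [] \<Longrightarrow> repeated T []"
  by (rule repeatedI[of 0 _ _ 1]) (auto simp: occs_def Suc_le_eq)

lemma repeated_prefix: "repeated T P \<Longrightarrow> prefix Q P \<Longrightarrow> repeated T Q"
proof -
  assume "repeated T P" "prefix Q P"
  moreover from \<open>prefix Q P\<close> have "occs T P \<subseteq> occs T Q"
    unfolding occs_def using prefix_order.trans by blast
  ultimately show ?thesis
    unfolding repeated_def freq_eq_card_occs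
    by (meson card_mono finite_occs le_trans)
qed

lemma occs_ConsD:
  assumes "k \<in> occs T (x # P)"
  shows "Suc k \<in> occs T P"
proof -
  have "drop k T \<noteq> []" using assms by (auto simp: occs_def)
  then have "k < length T" by simp
  with assms show ?thesis
    by (auto simp: occs_def Cons_nth_drop_Suc[symmetric])
qed

lemma repeated_ConsD: "repeated T (x # P) \<Longrightarrow> repeated T P"
proof -
  assume r: "repeated T (x # P)"
  obtain i where i: "i \<in> occs T (x # P)" using repeatedE[OF r] by blast
  obtain j where "j \<in> occs T (x # P)" "j \<noteq> i" using repeatedE[OF r] by blast
  with i show ?thesis
    by (intro repeatedI[of "Suc i" _ _ "Suc j"]) (auto dest: occs_ConsD)
qed

lemma repeated_drop_Suc: "repeated T (drop k T) \<Longrightarrow> k < length T \<Longrightarrow> repeated T (drop (Suc k) T)"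
  by (metis Cons_nth_drop_Suc repeated_ConsD)

text \<open>Hence a single threshold separates the suffixes that occur once from the repeated
  ones.\<close>

lemma repeated_drop_mono:
  "repeated T (drop k T) \<Longrightarrow> k \<le> j \<Longrightarrow> j \<le> length T \<Longrightarrow> repeated T (drop j T)"
  by (induction j) (auto simp: le_Suc_eq intro: repeated_drop_Suc)

lemma occs_self: "k \<le> length T \<Longrightarrow> k \<in> occs T (take l (drop k T))"
  by (simp add: occs_def take_is_prefix)

lemma not_repeated_text: "T \<noteq> [] \<Longrightarrow> \<not> repeated T T"
proof
  assume "T \<noteq> []" "repeated T T"
  then obtain j where "j \<in> occs T T" "j \<noteq> 0" using repeatedE by blast
  then show False
    using prefix_length_le[of T "drop j T"] \<open>T \<noteq> []\<close> by (auto simp: occs_def)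
qed


subsection \<open>Net occurrences\<close>

text \<open>This is \<open>L k\<close>. For nonempty \<open>T\<close> the set contains 0, so the
  maximum is meaningful.\<close>

definition rep_len :: "nat list \<Rightarrow> nat \<Rightarrow> nat" where
  "rep_len T k = Max {l. l \<le> length T - k \<and> repeated T (take l (drop k T))}"

definition rep_str :: "nat list \<Rightarrow> nat \<Rightarrow> nat list" where
  "rep_str T k = take (rep_len T k) (drop k T)"

definition net_start :: "nat list \<Rightarrow> nat \<Rightarrow> bool" where
  "net_start T k \<longleftrightarrow> k < length T \<and> rep_len T k > 0 \<and> (k = 0 \<or> rep_len T (k - 1) \<le> rep_len T k)"

text \<open>Repetition passes to prefixes, so the repeated lengths at \<open>k\<close> form an
  initial segment and the maximum decides every length.\<close>

lemma rep_len_props: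
  assumes "T \<noteq> []"
  shows "rep_len T k \<le> length T - k" "repeated T (rep_str T k)"
    "l \<le> length T - k \<Longrightarrow> repeated T (take l (drop k T)) \<longleftrightarrow> l \<le> rep_len T k"
proof -
  let ?A = "{l. l \<le> length T - k \<and> repeated T (take l (drop k T))}"
  have fin: "finite ?A" by (rule finite_subset[of _ "{..length T - k}"]) auto
  have "0 \<in> ?A" using repeated_Nil[OF assms] by simp
  then have M: "Max ?A \<in> ?A" using Max_in[OF fin] by blast
  then show 1: "rep_len T k \<le> length T - k" "repeated T (rep_str T k)"
    unfolding rep_len_def rep_str_def by auto
  assume l: "l \<le> length T - k"
  show "repeated T (take l (drop k T)) \<longleftrightarrow> l \<le> rep_len T k"
  proof
    assume "repeated T (take l (drop k T))"
    with l show "l \<le> rep_len T k"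
      unfolding rep_len_def using fin by (intro Max_ge) auto
  next
    assume "l \<le> rep_len T k"
    then have "prefix (take l (drop k T)) (rep_str T k)"
      unfolding rep_str_def by (metis min.absorb1 take_is_prefix take_take)
    with 1 show "repeated T (take l (drop k T))" using repeated_prefix by blast
  qed
qed

lemma length_rep_str: "T \<noteq> [] \<Longrightarrow> length (rep_str T k) = rep_len T k"
  using rep_len_props(1)[of T k] by (simp add: rep_str_def)

lemma rep_len_less:
  assumes "T \<noteq> []" "\<not> repeated T (drop k T)"
  shows "rep_len T k < length T - k"
  using assms rep_len_props(1)[OF assms(1), of k] rep_len_props(3)[OF assms(1), of "length T - k" k]
  by auto

lemma rep_len_repeated_suffix:
  assumes "T \<noteq> []" "repeated T (drop k T)"
  shows "rep_len T k = length T - k"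
  using assms rep_len_props(1)[OF assms(1), of k] rep_len_props(3)[OF assms(1), of "length T - k" k]
  by auto

text \<open>For length \<open>l\<close> from \<open>k\<close>, repetition means
  \<open>l \<le> L k\<close>, a unique right extension means \<open>L k \<le> l\<close>, and a
  unique left extension, the prefix of length \<open>l + 1\<close> at \<open>k - 1\<close>, means
  \<open>L (k - 1) \<le> l\<close>.\<close>

lemma net_occurrence_iff:
  assumes "T \<noteq> []"
  shows "net_occurrence T i j \<longleftrightarrow> (\<exists>k. i = Suc k \<and> j = k + rep_len T k \<and> net_start T k)"
proof -
  have main: "net_occurrence T (Suc k) (k + l) \<longleftrightarrow> l = rep_len T k \<and> net_start T k" if "l > 0" for k l
  proof (cases "k + l \<le> length T")
    case False
    then show ?thesis
      using that rep_len_props(1)[OF assms, of k]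
      by (auto simp: net_occurrence_def net_start_def)
  next
    case True
    have a: "freq T (substr T (Suc k) (k + l)) \<ge> 2 \<longleftrightarrow> l \<le> rep_len T k"
      using rep_len_props(3)[OF assms, of l k] True by (simp add: substr_Suc repeated_def)
    \<comment> \<open>At the right end of the text both sides hold, since \<open>l\<close> is then
      the full length of the suffix at \<open>k\<close>.\<close>
    have b: "k + l = length T \<or> freq T (substr T (Suc k) (k + l + 1)) = 1 \<longleftrightarrow> rep_len T k \<le> l"
    proof (cases "k + l = length T")
      case False
      have "freq T (substr T (Suc k) (k + l + 1)) = 1 \<longleftrightarrow> \<not> repeated T (take (l + 1) (drop k T))"
        using freq_eq_1_iff[OF occs_self[of k T "l + 1"]] substr_Suc[of T k "l + 1"] True by simp
      then show ?thesis
        using False True rep_len_props(3)[OF assms, of "l + 1" k] by auto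
    qed (use rep_len_props(1)[OF assms, of k] in auto)
    have c: "Suc k = 1 \<or> freq T (substr T (Suc k - 1) (k + l)) = 1 \<longleftrightarrow> k = 0 \<or> rep_len T (k - 1) \<le> l"
    proof (cases k)
      case (Suc q)
      have "freq T (substr T k (k + l)) = 1 \<longleftrightarrow> \<not> repeated T (take (l + 1) (drop q T))"
        using freq_eq_1_iff[OF occs_self[of q T "l + 1"]] substr_Suc[of T q "l + 1"] True Suc by simp
      then show ?thesis
        using Suc True rep_len_props(3)[OF assms, of "l + 1" q] by auto
    qed simp
    have "net_occurrence T (Suc k) (k + l) \<longleftrightarrow>
        l \<le> rep_len T k \<and> (k = 0 \<or> rep_len T (k - 1) \<le> l) \<and> rep_len T k \<le> l"
      unfolding net_occurrence_def a b c using that True by simp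
    then show ?thesis using that True by (auto simp: net_start_def)
  qed
  show ?thesis
  proof
    assume "net_occurrence T i j"
    moreover from this have "1 \<le> i" "i \<le> j" by (auto simp: net_occurrence_def)
    moreover from this have "i = Suc (i - 1)" "j = (i - 1) + (j + 1 - i)" "j + 1 - i > 0" by auto
    ultimately show "\<exists>k. i = Suc k \<and> j = k + rep_len T k \<and> net_start T k"
      using main by metis
  next
    assume "\<exists>k. i = Suc k \<and> j = k + rep_len T k \<and> net_start T k"
    then show "net_occurrence T i j"
      using main by (auto simp: net_start_def)
  qed
qed

text \<open>Each start carries at most one net occurrence, so intervals may be counted by their
  starts.\<close>

lemma net_freq_eq:
  assumes "T \<noteq> []"
  shows "net_freq T S = card {k. net_start T k \<and> rep_str T k = S}"
proof -
  have "{(i, j). net_occurrence T i j \<and> substr T i j = S}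
      = (\<lambda>k. (Suc k, k + rep_len T k)) ` {k. net_start T k \<and> rep_str T k = S}"
    unfolding net_occurrence_iff[OF assms]
    by (auto simp: substr_Suc rep_str_def image_iff)
  moreover have "inj_on (\<lambda>k. (Suc k, k + rep_len T k)) A" for A
    by (auto simp: inj_on_def)
  ultimately show ?thesis
    unfolding net_freq_def by (simp add: card_image)
qed

lemma finite_net_start [simp]: "finite {k. net_start T k \<and> Q k}"
  by (rule finite_subset[of _ "{..<length T}"]) (auto simp: net_start_def)


subsection \<open>The tree\<close>

lemma trie_nodes_iff: "P \<in> trie_nodes T \<longleftrightarrow> occs T P \<noteq> {}"
proof
  assume "P \<in> trie_nodes T"
  then obtain S where S: "suffix S T" "prefix P S" by (auto simp: trie_nodes_def)
  then have "S = drop (length T - length S) T"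
    by (metis append_eq_conv_conj suffix_def length_append add_diff_cancel_right')
  with S have "length T - length S \<in> occs T P" by (auto simp: occs_def)
  then show "occs T P \<noteq> {}" by blast
next
  assume "occs T P \<noteq> {}"
  then show "P \<in> trie_nodes T"
    by (auto simp: occs_def trie_nodes_def intro: suffix_drop)
qed

lemma trie_nodes_prefix: "P \<in> trie_nodes T \<Longrightarrow> prefix Q P \<Longrightarrow> Q \<in> trie_nodes T"
  unfolding trie_nodes_def using prefix_order.trans by blast

lemma drop_in_trie_nodes [simp]: "drop k T \<in> trie_nodes T"
  by (auto simp: trie_nodes_def intro: suffix_drop)

lemma trie_nodes_ConsD: "x # P \<in> trie_nodes T \<Longrightarrow> P \<in> trie_nodes T"
  unfolding trie_nodes_iff using occs_ConsD by blast

lemma trie_nodes_set: "P \<in> trie_nodes T \<Longrightarrow> set P \<subseteq> set T"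
  unfolding trie_nodes_def using set_mono_prefix set_mono_suffix by blast

lemma trie_children_subset: "trie_children T P \<subseteq> set T"
  unfolding trie_children_def using trie_nodes_set by fastforce

lemma finite_trie_children [simp]: "finite (trie_children T P)"
  using trie_children_subset by (rule finite_subset) simp

lemma card_trie_children_ge2:
  "card (trie_children T P) \<ge> 2 \<longleftrightarrow> (\<exists>c d. c \<noteq> d \<and> c \<in> trie_children T P \<and> d \<in> trie_children T P)"
proof
  assume a: "card (trie_children T P) \<ge> 2"
  then obtain c where c: "c \<in> trie_children T P" by fastforce
  have "\<not> trie_children T P \<subseteq> {c}" using a card_mono[of "{c}" "trie_children T P"] by auto
  with c show "\<exists>c d. c \<noteq> d \<and> c \<in> trie_children T P \<and> d \<in> trie_children T P" by blast
next
  assume "\<exists>c d. c \<noteq> d \<and> c \<in> trie_children T P \<and> d \<in> trie_children T P"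
  then obtain c d where "c \<noteq> d" "{c, d} \<subseteq> trie_children T P" by blast
  then show "card (trie_children T P) \<ge> 2"
    using card_mono[of "trie_children T P" "{c, d}"] by simp
qed

lemma strict_prefix_snocE:
  assumes "strict_prefix P V"
  shows "prefix (P @ [V ! length P]) V"
proof -
  obtain b bs where "V = P @ b # bs" using assms by (rule strict_prefixE')
  then show ?thesis by simp
qed

lemma Nil_in_ist_nodes: "[] \<in> ist_nodes T"
  by (auto simp: ist_nodes_def trie_nodes_def)

lemma ist_nodes_trie: "P \<in> ist_nodes T \<Longrightarrow> P \<in> trie_nodes T"
  by (simp add: ist_nodes_def)

section \<open>Leaves, branching nodes and edges\<close>

text \<open>An extension of the suffix at \<open>k\<close> needs more room than there is at
  \<open>k\<close>, so it occurs at some \<open>j < k\<close>, where the suffix then occurs a second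
  time.\<close>

lemma drop_is_leaf:
  assumes "\<not> repeated T (drop k T)" "k \<le> length T"
  shows "trie_children T (drop k T) = {}"
proof (rule ccontr)
  assume "trie_children T (drop k T) \<noteq> {}"
  then obtain c where "drop k T @ [c] \<in> trie_nodes T" by (auto simp: trie_children_def)
  then obtain j where j: "j \<le> length T" "prefix (drop k T @ [c]) (drop j T)"
    by (auto simp: trie_nodes_iff occs_def)
  then have "length T - k + 1 \<le> length T - j" using prefix_length_le by fastforce
  moreover from j have "j \<in> occs T (drop k T)"
    using append_prefixD by (auto simp: occs_def)
  moreover have "k \<in> occs T (drop k T)" using assms(2) by (simp add: occs_def)
  ultimately show False using assms repeatedI[of j T "drop k T" k] by auto
qed

text \<open>An occurrence that stops short of the end of the text would give \<open>P\<close> a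
  child. So every occurrence is a suffix, and suffixes of equal length have the same start.\<close>

lemma leaf_is_suffix:
  assumes "P \<in> trie_nodes T" "trie_children T P = {}"
  obtains k where "k \<le> length T" "P = drop k T" "\<not> repeated T P"
proof -
  have eq: "P = drop j T" if "j \<in> occs T P" for j
  proof (rule ccontr)
    assume "P \<noteq> drop j T"
    with that have "strict_prefix P (drop j T)" by (auto simp: occs_def strict_prefix_def)
    then have "prefix (P @ [drop j T ! length P]) (drop j T)" by (rule strict_prefix_snocE)
    then have "P @ [drop j T ! length P] \<in> trie_nodes T"
      using drop_in_trie_nodes trie_nodes_prefix by blast
    with assms(2) show False by (auto simp: trie_children_def)
  qed
  obtain k where k: "k \<in> occs T P" using assms(1) by (auto simp: trie_nodes_iff)
  have "\<not> repeated T P"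
  proof
    assume "repeated T P"
    then obtain j where j: "j \<in> occs T P" "j \<noteq> k" using repeatedE by blast
    then have "length (drop j T) = length (drop k T)" using eq[OF k] eq[of j] by simp
    with j k show False by (auto simp: occs_def)
  qed
  with k eq[OF k] that show thesis by (auto simp: occs_def)
qed

lemma leaf_iff:
  "k \<le> length T \<Longrightarrow> trie_children T (drop k T) = {} \<longleftrightarrow> \<not> repeated T (drop k T)"
  by (metis drop_in_trie_nodes drop_is_leaf leaf_is_suffix)

lemma branching_repeated:
  assumes "card (trie_children T P) \<ge> 2"
  shows "repeated T P"
proof -
  obtain c d where cd: "c \<noteq> d" "P @ [c] \<in> trie_nodes T" "P @ [d] \<in> trie_nodes T"
    using assms[unfolded card_trie_children_ge2] unfolding trie_children_def by blast
  then obtain i j where ij: "i \<in> occs T (P @ [c])" "j \<in> occs T (P @ [d])"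
    by (auto simp: trie_nodes_iff)
  then have "i \<noteq> j" using cd(1)
    by (auto simp: occs_def prefix_def)
  moreover have "i \<in> occs T P" "j \<in> occs T P"
    using ij append_prefixD by (auto simp: occs_def)
  ultimately show ?thesis using repeatedI by blast
qed

text \<open>A longest trie string that extends \<open>P @ [c]\<close> is a leaf, so there are nodes
  that extend it. A shortest such node is the lower end of the edge.\<close>

lemma ex_child_edge:
  assumes "P \<in> ist_nodes T" "c \<in> trie_children T P"
  obtains V where "ist_edge T P V" "V ! length P = c"
proof -
  let ?A = "\<lambda>V. V \<in> trie_nodes T \<and> prefix (P @ [c]) V"
  have A: "?A (P @ [c])" using assms(2) by (simp add: trie_children_def)
  have "length V \<le> length T" if "V \<in> trie_nodes T" for V
    using that unfolding trie_nodes_def by (auto dest!: prefix_length_le suffix_length_le)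
  then have b: "\<forall>V. ?A V \<longrightarrow> length V < Suc (length T)" by (simp add: less_Suc_eq_le)
  obtain V where V: "?A V" "\<forall>W. ?A W \<longrightarrow> length W \<le> length V"
    using ex_has_greatest_nat[of ?A _ length, OF A b] by blast
  have "trie_children T V = {}"
  proof (rule ccontr)
    assume "trie_children T V \<noteq> {}"
    then obtain d where "?A (V @ [d])" using V(1) by (auto simp: trie_children_def)
    with V(2) show False by fastforce
  qed
  with V(1) have "V \<in> ist_nodes T" by (simp add: ist_nodes_def)
  let ?B = "\<lambda>V. V \<in> ist_nodes T \<and> prefix (P @ [c]) V"
  obtain W where W: "?B W" "\<forall>V. ?B V \<longrightarrow> length W \<le> length V"
    using ex_has_least_nat[of ?B V length] V \<open>V \<in> ist_nodes T\<close> by blast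
  have "strict_prefix P W" using W(1) by (auto simp: prefix_def strict_prefix_def)
  moreover have "\<not> (\<exists>X\<in>ist_nodes T. strict_prefix P X \<and> strict_prefix X W)"
  proof
    assume "\<exists>X\<in>ist_nodes T. strict_prefix P X \<and> strict_prefix X W"
    then obtain X where X: "X \<in> ist_nodes T" "strict_prefix P X" "strict_prefix X W" by blast
    \<comment> \<open>\<open>X\<close> is a prefix of \<open>W\<close> longer than \<open>P\<close>,
      so it still passes through the letter \<open>c\<close>.\<close>
    have "prefix (P @ [c]) X"
      using prefix_length_prefix[of "P @ [c]" W X] W(1) X prefix_length_less[OF X(2)]
      by (auto simp: strict_prefix_def)
    with W(2) X have "length W \<le> length X" by blast
    with prefix_length_less[OF X(3)] show False by simp
  qed
  ultimately have "ist_edge T P W" using W(1) assms(1) by (simp add: ist_edge_def)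
  moreover have "W ! length P = c" using W(1) by (auto simp: prefix_def)
  ultimately show thesis using that by blast
qed

lemma ex_parent_edge:
  assumes "V \<in> ist_nodes T" "V \<noteq> []"
  obtains U where "ist_edge T U V"
proof -
  let ?A = "\<lambda>U. U \<in> ist_nodes T \<and> strict_prefix U V"
  have A: "?A []" using assms(2) Nil_in_ist_nodes by (auto simp: strict_prefix_def)
  have b: "\<forall>U. ?A U \<longrightarrow> length U < length V" using prefix_length_less by blast
  obtain U where U: "?A U" "\<forall>W. ?A W \<longrightarrow> length W \<le> length U"
    using ex_has_greatest_nat[of ?A _ length, OF A b] by blast
  then have "ist_edge T U V"
    using assms(1) prefix_length_less unfolding ist_edge_def by (meson leD)
  then show thesis using that by blast
qed

text \<open>Two parents are prefixes of one string, hence comparable, and neither may lie strictly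
  inside the edge of the other.\<close>

lemma edge_parent_unique:
  assumes "ist_edge T U V" "ist_edge T U' V"
  shows "U = U'"
proof -
  have "prefix U U' \<or> prefix U' U"
    using assms prefix_same_cases by (auto simp: ist_edge_def strict_prefix_def)
  with assms show ?thesis unfolding ist_edge_def strict_prefix_def by blast
qed

text \<open>Two different lower ends are incomparable. They agree on the letter after
  \<open>U\<close>, so they part strictly below \<open>U\<close>, and the branching node there lies
  inside both edges.\<close>

lemma edge_child_unique:
  assumes "ist_edge T U V" "ist_edge T U V'" "V ! length U = V' ! length U"
  shows "V = V'"
proof (rule ccontr)
  assume ne: "V \<noteq> V'"
  note e = assms(1,2)[unfolded ist_edge_def]
  have "\<not> strict_prefix V V'" "\<not> strict_prefix V' V" using e by blast+
  with ne have "V \<parallel> V'" by (auto simp: strict_prefix_def)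
  then obtain P b bs c cs where d: "b \<noteq> c" "V = P @ b # bs" "V' = P @ c # cs"
    using parallel_decomp by blast
  have "prefix U P"
  proof -
    have "prefix U P \<or> prefix P U"
      using e d prefix_same_cases by (metis prefixI strict_prefix_def)
    \<comment> \<open>If they parted above \<open>U\<close>, both would continue after
      \<open>P\<close> with the letter of \<open>U\<close>.\<close>
    moreover have False if "strict_prefix P U"
    proof -
      have "prefix (P @ [U ! length P]) V" "prefix (P @ [U ! length P]) V'"
        using strict_prefix_snocE[OF that] e prefix_order.trans by (auto simp: strict_prefix_def)
      with d show False by simp
    qed
    ultimately show ?thesis by (auto simp: strict_prefix_def)
  qed
  moreover have "U \<noteq> P" using assms(3) d by auto
  moreover have "b \<in> trie_children T P" "c \<in> trie_children T P"
    using e d trie_nodes_prefix[OF ist_nodes_trie[of V T], of "P @ [b]"]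
      trie_nodes_prefix[OF ist_nodes_trie[of V' T], of "P @ [c]"]
    by (auto simp: trie_children_def)
  then have "P \<in> ist_nodes T"
    using d(1) card_trie_children_ge2 trie_nodes_prefix[of "P @ [b]" T P]
    by (auto simp: ist_nodes_def trie_children_def)
  moreover have "strict_prefix P V" using d by (auto simp: strict_prefix_def)
  ultimately show False using e by (auto simp: strict_prefix_def)
qed

section \<open>Longest repeated prefixes as nodes and implicit nodes\<close>

text \<open>After \<open>j\<close>, a letter other than that at \<open>k\<close> would make
  \<open>P\<close> branch, and the same letter would make the prefix at \<open>k\<close> that is one
  longer repeated. So no letter follows.\<close>

lemma repeated_not_node:
  assumes P: "k \<in> occs T P" "P \<notin> ist_nodes T" "strict_prefix P (drop k T)"
    and nr: "\<not> repeated T (take (Suc (length P)) (drop k T))"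
    and j: "j \<in> occs T P" "j \<noteq> k"
  shows "drop j T = P"
proof (rule ccontr)
  assume "drop j T \<noteq> P"
  with j have sj: "strict_prefix P (drop j T)" by (auto simp: occs_def strict_prefix_def)
  define c where "c = drop k T ! length P"
  define d where "d = drop j T ! length P"
  have c: "prefix (P @ [c]) (drop k T)" and d: "prefix (P @ [d]) (drop j T)"
    unfolding c_def d_def using strict_prefix_snocE P(3) sj by auto
  then have "c \<in> trie_children T P" "d \<in> trie_children T P"
    using trie_nodes_prefix[OF drop_in_trie_nodes] by (auto simp: trie_children_def)
  moreover have "P \<in> trie_nodes T" using P(1) by (auto simp: trie_nodes_iff)
  ultimately have "c = d" using P(2) card_trie_children_ge2 by (auto simp: ist_nodes_def)
  then have "j \<in> occs T (P @ [c])" "k \<in> occs T (P @ [c])"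
    using c d P(1) j(1) by (auto simp: occs_def)
  then have "repeated T (P @ [c])" using j(2) repeatedI by blast
  moreover have "P @ [c] = take (Suc (length P)) (drop k T)"
    using c by (auto simp: prefix_iff_take)
  ultimately show False using nr by simp
qed

lemma rep_str_not_node:
  assumes T: "T \<noteq> []" and k: "k \<le> length T" and nr: "\<not> repeated T (drop k T)"
    and nn: "rep_str T k \<notin> ist_nodes T"
    and j: "j \<in> occs T (rep_str T k)" "j \<noteq> k"
  shows "drop j T = rep_str T k"
proof (rule repeated_not_node[OF _ nn _ _ j])
  have l: "rep_len T k < length T - k" using rep_len_less[OF T nr] .
  show "k \<in> occs T (rep_str T k)" unfolding rep_str_def using occs_self[OF k] .
  show "strict_prefix (rep_str T k) (drop k T)"
    using l length_rep_str[OF T, of k] by (auto simp: strict_prefix_def rep_str_def take_is_prefix)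
  show "\<not> repeated T (take (Suc (length (rep_str T k))) (drop k T))"
    using l rep_len_props(3)[OF T, of "Suc (rep_len T k)" k] length_rep_str[OF T, of k] by auto
qed

text \<open>The hypotheses on \<open>m\<close> say that \<open>drop m T\<close> is the longest
  repeated suffix. Thus all net strings that are not nodes coincide, and they can share one
  counter.\<close>

lemma net_not_node_eq_longest_repeated_suffix:
  assumes T: "T \<noteq> []" and net: "net_start T k"
    and nn: "rep_str T k \<notin> ist_nodes T"
    and m: "m \<le> length T" "repeated T (drop m T)" "\<And>i. i < m \<Longrightarrow> \<not> repeated T (drop i T)"
  shows "rep_str T k = drop m T"
proof (cases "k < m")
  case False
  \<comment> \<open>Past \<open>m\<close>, both \<open>k - 1\<close> and \<open>k\<close> start
    repeated suffixes, so the length drops by one and \<open>k\<close> is no net start.\<close>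
  have "k = m"
  proof (rule ccontr)
    assume "k \<noteq> m"
    with False have km: "k > m" by simp
    have kl: "k < length T" using net by (simp add: net_start_def)
    have "rep_len T k = length T - k" "rep_len T (k - 1) = length T - (k - 1)"
      by (rule rep_len_repeated_suffix[OF T]; use km kl repeated_drop_mono[OF m(2)] in simp)+
    with km kl net show False by (auto simp: net_start_def)
  qed
  with rep_len_repeated_suffix[OF T m(2)] show ?thesis by (simp add: rep_str_def)
next
  case True
  let ?S = "rep_str T k"
  note nr = m(3)[OF True]
  have kn: "k \<le> length T" using True m by simp
  note rn = rep_str_not_node[OF T kn nr nn]
  obtain j where j: "j \<in> occs T ?S" "j \<noteq> k" using repeatedE[OF rep_len_props(2)[OF T, of k]] by blast
  have dj: "drop j T = ?S" by (rule rn[OF j])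
  \<comment> \<open>Otherwise the suffix at \<open>j - 1\<close> is repeated as well. Its second
    occurrence \<open>q\<close> must lie just before \<open>k\<close>, so the left extension at
    \<open>k\<close> is repeated.\<close>
  have "j = m"
  proof (rule ccontr)
    assume "j \<noteq> m"
    moreover have "j \<ge> m" using m(3)[of j] dj rep_len_props(2)[OF T, of k] by (metis not_le)
    ultimately have jm: "j > m" by simp
    have jn: "j \<le> length T" using j by (auto simp: occs_def)
    have r: "repeated T (drop (j - 1) T)" using repeated_drop_mono[OF m(2)] jm jn by simp
    have cons: "drop (j - 1) T = T ! (j - 1) # ?S"
      using Cons_nth_drop_Suc[of "j - 1" T] jm jn dj by simp
    obtain q where q: "q \<in> occs T (T ! (j - 1) # ?S)" "q \<noteq> j - 1"
      using repeatedE[OF r] cons by metis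
    have sq: "Suc q \<in> occs T ?S" using q occs_ConsD by blast
    \<comment> \<open>Any occurrence other than \<open>k\<close> is a suffix as long as the one at
      \<open>j\<close>, which would give \<open>q = j - 1\<close>.\<close>
    have "Suc q = k"
    proof (rule ccontr)
      assume "Suc q \<noteq> k"
      from rn[OF sq this] have "length (drop (Suc q) T) = length (drop j T)" using dj by simp
      moreover have "Suc q \<le> length T" using sq by (auto simp: occs_def)
      ultimately show False using jn jm q(2) by simp
    qed
    then have kq: "k > 0" "q = k - 1" by auto
    have "prefix (drop (j - 1) T) (drop (k - 1) T)" using q cons kq by (simp add: occs_def)
    then have "repeated T (take (length (drop (j - 1) T)) (drop (k - 1) T))"
      using r by (metis prefix_iff_take)
    moreover have "length (drop (j - 1) T) = Suc (rep_len T k)"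
      using cons length_rep_str[OF T, of k] by simp
    moreover from this have "Suc (rep_len T k) \<le> length T - (k - 1)"
      using prefix_length_le[OF \<open>prefix (drop (j - 1) T) (drop (k - 1) T)\<close>] by simp
    ultimately have "Suc (rep_len T k) \<le> rep_len T (k - 1)"
      using rep_len_props(3)[OF T] by auto
    with net kq show False by (simp add: net_start_def)
  qed
  with dj show ?thesis by simp
qed

text \<open>The parent \<open>U\<close> is repeated, so the longest repeated prefix extends
  \<open>U\<close>. If it differs from \<open>U\<close>, it lies inside the edge, is no node, and
  its further occurrences are suffixes: it is an implicit node. Every implicit node on the edge is a
  repeated prefix, so none is deeper.\<close>

lemma rep_len_leaf:
  assumes T: "T \<noteq> []" and k: "k \<le> length T" and nr: "\<not> repeated T (drop k T)"
    and e: "ist_edge T U (drop k T)"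
  defines "A \<equiv> implicit_offsets T U (drop k T)"
  shows "rep_len T k = length U + (if A = {} then 0 else Max A)"
    and "A = {} \<Longrightarrow> rep_str T k = U"
    and "A \<noteq> {} \<Longrightarrow> rep_str T k \<notin> ist_nodes T"
    and "finite A"
proof -
  let ?V = "drop k T" and ?S = "rep_str T k"
  have UV: "strict_prefix U ?V" "U \<in> ist_nodes T" using e by (auto simp: ist_edge_def)
  have l: "rep_len T k < length T - k" using rep_len_less[OF T nr] .
  have SV: "strict_prefix ?S ?V"
    using l length_rep_str[OF T, of k] by (auto simp: strict_prefix_def rep_str_def take_is_prefix)
  have len: "length P \<le> rep_len T k" if "prefix P ?V" "repeated T P" for P
    using that rep_len_props(3)[OF T, of "length P" k] prefix_length_le[OF that(1)]
    by (simp add: prefix_iff_take)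
  \<comment> \<open>Having a child, \<open>U\<close> is the root or a branching node.\<close>
  have "repeated T U"
  proof (cases "U = []")
    case False
    have "trie_children T U \<noteq> {}"
      using trie_nodes_prefix[OF drop_in_trie_nodes strict_prefix_snocE[OF UV(1)]]
      by (auto simp: trie_children_def)
    with False UV(2) show ?thesis by (auto simp: ist_nodes_def intro: branching_repeated)
  qed (simp add: repeated_Nil T)
  then have "length U \<le> rep_len T k" using len UV by (simp add: strict_prefix_def)
  then have US: "prefix U ?S"
    using prefix_length_prefix[of U ?V ?S] UV SV length_rep_str[OF T, of k] by (auto simp: strict_prefix_def)
  have S_imp: "?S \<in> implicit_nodes T U ?V" if "?S \<noteq> U"
  proof -
    have s: "strict_prefix U ?S" using US that by (auto simp: strict_prefix_def)
    then have nn: "?S \<notin> ist_nodes T" using e SV by (auto simp: ist_edge_def)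
    obtain j where j: "j \<in> occs T ?S" "j \<noteq> k" using repeatedE[OF rep_len_props(2)[OF T, of k]] by blast
    have "drop j T = ?S" by (rule rep_str_not_node[OF T k nr nn j])
    then have "suffix ?S T" by (metis suffix_drop)
    with s SV rep_len_props(2)[OF T, of k] show ?thesis
      by (simp add: implicit_nodes_def repeated_def)
  qed
  have imp: "length P \<le> rep_len T k" "strict_prefix U P" if "P \<in> implicit_nodes T U ?V" for P
    using that len by (auto simp: implicit_nodes_def strict_prefix_def repeated_def)
  show fin: "finite A"
  proof (rule finite_subset[of _ "{..rep_len T k}"])
    show "A \<subseteq> {..rep_len T k}" using imp(1) unfolding A_def implicit_offsets_def by fastforce
  qed simp
  show 2: "?S = U" if "A = {}"
    using that S_imp by (auto simp: A_def implicit_offsets_def)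
  have 3: "?S \<noteq> U" if "A \<noteq> {}"
  proof -
    obtain P where P: "P \<in> implicit_nodes T U ?V" using \<open>A \<noteq> {}\<close> by (auto simp: A_def implicit_offsets_def)
    then have "length U < length ?S"
      using imp[OF P] prefix_length_less[of U P] length_rep_str[OF T, of k] by simp
    then show ?thesis by auto
  qed
  then show "?S \<notin> ist_nodes T" if "A \<noteq> {}"
    using that e SV US by (auto simp: ist_edge_def strict_prefix_def)
  show "rep_len T k = length U + (if A = {} then 0 else Max A)"
  proof (cases "A = {}")
    case True
    then show ?thesis using 2 length_rep_str[OF T, of k] by simp
  next
    case False
    have "Max A = rep_len T k - length U"
    proof (rule Max_eqI[OF fin])
      show "rep_len T k - length U \<in> A"
        using S_imp[OF 3[OF False]] length_rep_str[OF T, of k]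
        by (force simp: A_def implicit_offsets_def)
      show "a \<le> rep_len T k - length U" if "a \<in> A" for a
        using that imp(1) by (auto simp: A_def implicit_offsets_def diff_le_mono)
    qed
    then show ?thesis using \<open>length U \<le> rep_len T k\<close> False by simp
  qed
qed

text \<open>This singles out the leaf of the whole text. The left extension of a shorter leaf is
  again a leaf and hence a node, so a Weiner link leads to it, whereas \<open>x # T\<close> is too
  long to occur.\<close>

lemma text_node_iff:
  assumes T: "T \<noteq> []" and P: "P \<in> ist_nodes T"
  shows "P = T \<longleftrightarrow> trie_children T P = {} \<and> (\<forall>x\<in>set T. x # P \<notin> ist_nodes T)"
proof
  assume "P = T"
  have "x # T \<notin> trie_nodes T" for x
  proof
    assume "x # T \<in> trie_nodes T"
    then obtain k where "prefix (x # T) (drop k T)" by (auto simp: trie_nodes_iff occs_def)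
    then show False using prefix_length_le by fastforce
  qed
  with \<open>P = T\<close> show "trie_children T P = {} \<and> (\<forall>x\<in>set T. x # P \<notin> ist_nodes T)"
    using drop_is_leaf[of T 0] not_repeated_text[OF T] ist_nodes_trie by auto
next
  assume a: "trie_children T P = {} \<and> (\<forall>x\<in>set T. x # P \<notin> ist_nodes T)"
  then obtain k where k: "k \<le> length T" "P = drop k T"
    using leaf_is_suffix P ist_nodes_trie by metis
  show "P = T"
  proof (rule ccontr)
    assume "P \<noteq> T"
    with k have k0: "k > 0" by (cases k) auto
    let ?x = "T ! (k - 1)"
    have c: "drop (k - 1) T = ?x # P" using Cons_nth_drop_Suc[of "k - 1" T] k k0 by simp
    \<comment> \<open>Deleting \<open>?x\<close> turns a child of \<open>?x # P\<close> into a child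
      of \<open>P\<close>.\<close>
    have "trie_children T (?x # P) = {}"
      using a trie_nodes_ConsD by (fastforce simp: trie_children_def)
    then have "?x # P \<in> ist_nodes T"
      using c drop_in_trie_nodes[of "k - 1" T] by (simp add: ist_nodes_def)
    moreover have "?x \<in> set T" using k k0 by simp
    ultimately show False using a by blast
  qed
qed


subsection \<open>The size of the tree\<close>

text \<open>These are the branching points of the trie of an arbitrary set of strings, which allows
  adding the strings one at a time.\<close>

definition forks :: "nat list set \<Rightarrow> nat list set" where
  "forks A = {P. \<exists>c d. c \<noteq> d \<and> (\<exists>x\<in>A. prefix (P @ [c]) x) \<and> (\<exists>y\<in>A. prefix (P @ [d]) y)}"

text \<open>An added string creates at most one branching point, namely where it leaves the trie
  built so far.\<close>

lemma card_forks:
  assumes "finite A"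
  shows "finite (forks A) \<and> card (forks A) \<le> card A"
  using assms
proof induction
  case empty
  then show ?case by (simp add: forks_def)
next
  case (insert x A)
  let ?N = "forks (insert x A) - forks A"
  \<comment> \<open>At a new fork \<open>P\<close>, the string \<open>x\<close> continues with a
    letter that no string of \<open>A\<close> takes there, although some string of \<open>A\<close>
    passes through \<open>P\<close>.\<close>
  have new: "\<exists>c. prefix (P @ [c]) x \<and> (\<forall>a\<in>A. \<not> prefix (P @ [c]) a) \<and> (\<exists>a\<in>A. prefix P a)"
    if P: "P \<in> ?N" for P
  proof -
    obtain c d where cd: "c \<noteq> d" "prefix (P @ [c]) x" "\<exists>a\<in>A. prefix (P @ [d]) a"
    proof -
      obtain c d where "c \<noteq> d" "\<exists>y\<in>insert x A. prefix (P @ [c]) y" "\<exists>y\<in>insert x A. prefix (P @ [d]) y"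
        using P unfolding forks_def by blast
      moreover from this have "\<not> (prefix (P @ [c]) x \<and> prefix (P @ [d]) x)"
        using prefix_length_prefix[of "P @ [c]" x "P @ [d]"] by auto
      moreover have "\<not> ((\<exists>y\<in>A. prefix (P @ [c]) y) \<and> (\<exists>y\<in>A. prefix (P @ [d]) y))"
        using P \<open>c \<noteq> d\<close> unfolding forks_def by blast
      ultimately show thesis using that[of c d] that[of d c] by auto
    qed
    moreover from this P have "\<forall>a\<in>A. \<not> prefix (P @ [c]) a" unfolding forks_def by blast
    moreover from cd have "\<exists>a\<in>A. prefix P a" using append_prefixD by blast
    ultimately show ?thesis by blast
  qed
  \<comment> \<open>Some string of \<open>A\<close> follows \<open>x\<close> down to the longer fork
    \<open>Q\<close>, and so takes the letter of \<open>x\<close> at \<open>P\<close>.\<close>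
  have nstrict: False if PQ: "P \<in> ?N" "Q \<in> ?N" "strict_prefix P Q" for P Q
  proof -
    obtain c where c: "prefix (P @ [c]) x" "\<forall>a\<in>A. \<not> prefix (P @ [c]) a" using new[OF PQ(1)] by blast
    obtain a where a: "prefix Q x" "a \<in> A" "prefix Q a" using new[OF PQ(2)] append_prefixD by blast
    have "prefix (P @ [c]) Q"
      using prefix_length_prefix[OF c(1) a(1)] prefix_length_less[OF PQ(3)] by simp
    with a c show False using prefix_order.trans by blast
  qed
  have eq: "P = Q" if "P \<in> ?N" "Q \<in> ?N" for P Q
  proof -
    have "prefix P x" "prefix Q x" using new that append_prefixD by blast+
    then have "prefix P Q \<or> prefix Q P" using prefix_same_cases by blast
    with nstrict[OF that] nstrict[OF that(2,1)] show ?thesis by (auto simp: strict_prefix_def)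
  qed
  have N: "finite ?N \<and> card ?N \<le> 1"
  proof (cases "?N = {}")
    case True
    then show ?thesis by (metis card.empty finite.emptyI le0)
  next
    case False
    then obtain P where "P \<in> ?N" by blast
    then have "Q = P" if "Q \<in> ?N" for Q using that by (intro eq)
    then have "?N \<subseteq> {P}" by blast
    then show ?thesis
      using card_mono[of "{P}" ?N] finite_subset[of ?N "{P}"] by simp
  qed
  have sub: "forks (insert x A) \<subseteq> forks A \<union> ?N" by blast
  have "card (forks (insert x A)) \<le> card (forks A \<union> ?N)"
    using sub N insert.IH by (intro card_mono) auto
  also have "\<dots> \<le> card (forks A) + card ?N" by (rule card_Un_le)
  also have "\<dots> \<le> card (insert x A)" using N insert by simp
  finally show ?case using sub N insert.IH finite_subset by blast
qed

text \<open>The bound adds the root, at most \<open>length T + 1\<close> suffixes as leaves, and at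
  most as many branching points.\<close>

lemma card_ist_nodes: "finite (ist_nodes T) \<and> card (ist_nodes T) \<le> 2 * length T + 3"
proof -
  let ?S = "(\<lambda>k. drop k T) ` {..length T}"
  have cS: "card ?S \<le> Suc (length T)" using card_image_le[of "{..length T}" "\<lambda>k. drop k T"] by simp
  have "P \<in> {[]} \<union> ?S \<union> forks ?S" if P: "P \<in> ist_nodes T" for P
  proof -
    consider "P = []" | "trie_children T P = {}" | "card (trie_children T P) \<ge> 2"
      using P by (auto simp: ist_nodes_def)
    then show ?thesis
    proof cases
      case 2
      then show ?thesis using leaf_is_suffix[OF ist_nodes_trie[OF P]] by blast
    next
      case 3
      then have "P \<in> forks ?S"
        unfolding card_trie_children_ge2 forks_def
        by (fastforce simp: trie_children_def trie_nodes_iff occs_def)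
      then show ?thesis by simp
    qed simp
  qed
  then have sub: "ist_nodes T \<subseteq> {[]} \<union> ?S \<union> forks ?S" by blast
  have f: "finite (forks ?S)" "card (forks ?S) \<le> card ?S" using card_forks[of ?S] by auto
  have "card (ist_nodes T) \<le> card ({[]} \<union> ?S \<union> forks ?S)"
    using f by (intro card_mono sub) auto
  also have "\<dots> \<le> card {[] :: nat list} + card ?S + card (forks ?S)"
    using card_Un_le[of "{[]} \<union> ?S" "forks ?S"] card_Un_le[of "{[]}" ?S] by linarith
  also have "\<dots> \<le> 2 * length T + 3" using cS f(2) by simp
  finally show ?thesis using f sub finite_subset by blast
qed


subsection \<open>Weakest preconditions\<close>

text \<open>Only for loop-free programs, whose running time has a bound that depends on the program alone.\<close>

primrec wp :: "nat \<Rightarrow> ist \<Rightarrow> com \<Rightarrow> (state \<Rightarrow> bool) \<Rightarrow> state \<Rightarrow> bool" where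
  "wp W D Skip Q s \<longleftrightarrow> Q s"
| "wp W D (Assign x e) Q s \<longleftrightarrow>
     eval_exp D s e \<le> W \<and> Q (s\<lparr>regs := (regs s)(x := eval_exp D s e)\<rparr>)"
| "wp W D (Store a e1 e2) Q s \<longleftrightarrow> eval_exp D s e1 \<le> W \<and> eval_exp D s e2 \<le> W \<and>
     Q (s\<lparr>arrs := (arrs s)(a := (arrs s a)(eval_exp D s e1 := eval_exp D s e2))\<rparr>)"
| "wp W D (Emit e1 e2 e3) Q s \<longleftrightarrow>
     Q (s\<lparr>emitted := emitted s @ [(eval_exp D s e1, eval_exp D s e2, eval_exp D s e3)]\<rparr>)"
| "wp W D (Seq c1 c2) Q s \<longleftrightarrow> wp W D c1 (wp W D c2 Q) s"
| "wp W D (Cond b c1 c2) Q s \<longleftrightarrow> (if eval_test D s b then wp W D c1 Q s else wp W D c2 Q s)"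
| "wp W D (While b c) Q s \<longleftrightarrow> False"

text \<open>This is an upper bound, since a conditional is charged for both branches.\<close>

primrec time :: "com \<Rightarrow> nat" where
  "time Skip = 1"
| "time (Assign x e) = 1 + exp_cost e"
| "time (Store a e1 e2) = 1 + exp_cost e1 + exp_cost e2"
| "time (Emit e1 e2 e3) = 1 + exp_cost e1 + exp_cost e2 + exp_cost e3"
| "time (Seq c1 c2) = time c1 + time c2"
| "time (Cond b c1 c2) = 1 + test_cost b + time c1 + time c2"
| "time (While b c) = 0"

definition runs :: "nat \<Rightarrow> ist \<Rightarrow> com \<Rightarrow> state \<Rightarrow> nat \<Rightarrow> (state \<Rightarrow> bool) \<Rightarrow> bool" where
  "runs W D c s m Q \<longleftrightarrow> (\<exists>t s'. exec W D c s t s' \<and> t \<le> m \<and> Q s')"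

lemma runs_wp: "wp W D c Q s \<Longrightarrow> runs W D c s (time c) Q"
proof (induction c arbitrary: Q s)
  case Skip
  then show ?case using exec.skip[of W D s] by (force simp: runs_def)
next
  case (Assign x e)
  then show ?case using exec.assign[of D s e W x] by (force simp: runs_def)
next
  case (Store a e1 e2)
  then show ?case using exec.store[of D s e1 W e2 a] by (force simp: runs_def)
next
  case (Emit e1 e2 e3)
  then show ?case using exec.emit[of W D e1 e2 e3 s] by (force simp: runs_def)
next
  case (Seq c1 c2)
  from Seq.IH(1)[of "wp W D c2 Q" s] Seq.prems
  obtain t1 s1 where 1: "exec W D c1 s t1 s1" "t1 \<le> time c1" "wp W D c2 Q s1"
    by (auto simp: runs_def)
  from Seq.IH(2)[OF 1(3)] obtain t2 s2 where "exec W D c2 s1 t2 s2" "t2 \<le> time c2" "Q s2"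
    by (auto simp: runs_def)
  with 1 exec.seq[OF 1(1) this(1)] show ?case by (force simp: runs_def)
next
  case (Cond b c1 c2)
  show ?case
  proof (cases "eval_test D s b")
    case True
    then obtain t1 s1 where "exec W D c1 s t1 s1" "t1 \<le> time c1" "Q s1"
      using Cond.prems Cond.IH(1)[of Q s] by (auto simp: runs_def)
    with exec.cond_true[OF True this(1), of c2] show ?thesis by (force simp: runs_def)
  next
    case False
    then obtain t1 s1 where "exec W D c2 s t1 s1" "t1 \<le> time c2" "Q s1"
      using Cond.prems Cond.IH(2)[of Q s] by (auto simp: runs_def)
    with exec.cond_false[OF False this(1), of c1] show ?thesis by (force simp: runs_def)
  qed
qed simp

lemma runs_mono: "runs W D c s m Q \<Longrightarrow> m \<le> m' \<Longrightarrow> (\<And>s. Q s \<Longrightarrow> R s) \<Longrightarrow> runs W D c s m' R"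
  unfolding runs_def using le_trans by blast

lemma runs_seq:
  "runs W D c1 s m1 R \<Longrightarrow> (\<And>s1. R s1 \<Longrightarrow> runs W D c2 s1 m2 Q) \<Longrightarrow> runs W D (Seq c1 c2) s (m1 + m2) Q"
  unfolding runs_def by (meson add_mono exec.seq)

text \<open>The measure drops in every round, so there are at most \<open>\<mu> s\<close> rounds;
  \<open>Suc\<close> pays for the final failing test.\<close>

lemma runs_while:
  assumes body: "\<And>s. I s \<Longrightarrow> eval_test D s b \<Longrightarrow> wp W D c (\<lambda>s'. I s' \<and> \<mu> s' < \<mu> s) s"
  assumes "I s"
  shows "runs W D (While b c) s (Suc (\<mu> s) * (1 + test_cost b + time c))
    (\<lambda>s'. I s' \<and> \<not> eval_test D s' b)"
  using assms(2)
proof (induction "\<mu> s :: nat" arbitrary: s rule: less_induct)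
  case less
  show ?case
  proof (cases "eval_test D s b")
    case False
    then show ?thesis using less.prems exec.while_false[OF False, of W c]
      by (force simp: runs_def)
  next
    case True
    obtain t1 s1 where 1: "exec W D c s t1 s1" "t1 \<le> time c" "I s1" "\<mu> s1 < \<mu> s"
      using runs_wp[OF body[OF less.prems True]] by (auto simp: runs_def)
    obtain t2 s2 where 2: "exec W D (While b c) s1 t2 s2"
      "t2 \<le> Suc (\<mu> s1) * (1 + test_cost b + time c)" "I s2" "\<not> eval_test D s2 b"
      using less.hyps[OF 1(4,3)] by (auto simp: runs_def)
    have "t2 \<le> \<mu> s * (1 + test_cost b + time c)"
      using 2(2) 1(4) by (meson Suc_leI le_trans mult_le_mono1)
    then have "1 + test_cost b + t1 + t2 \<le> Suc (\<mu> s) * (1 + test_cost b + time c)"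
      using 1(2) by simp
    then show ?thesis using exec.while_true[OF True 1(1) 2(1)] 2(3,4) unfolding runs_def by blast
  qed
qed


subsection \<open>The program\<close>

text \<open>Register 0 is the loop counter, register 1 a node, register 2 the value of \<^const>\<open>rep_len\<close> at the
  previous start, register 3 the current start (counted from 0), register 4 its
  \<^const>\<open>rep_len\<close> and register 5 the node of its \<^const>\<open>rep_str\<close>, or 0 if that string is not a node.
  Array 0 holds the parents. Arrays 1, 2 and 3 hold, for each value of register 5, the number of
  net occurrences found, the start of one of them and its length.\<close>

primrec conj_upto :: "(nat \<Rightarrow> test) \<Rightarrow> nat \<Rightarrow> test" where
  "conj_upto f 0 = Eq (Const 0) (Const 0)"
| "conj_upto f (Suc j) = Conj (conj_upto f j) (f j)"

lemma eval_conj_upto [simp]: "eval_test D s (conj_upto f j) \<longleftrightarrow> (\<forall>c<j. eval_test D s (f c))"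
  by (induction j) (auto simp: less_Suc_eq)

text \<open>The conjunction is unrolled over the alphabet, which is fixed with the program, so the
  test has constant cost.\<close>

definition leaf_test :: "nat \<Rightarrow> exp \<Rightarrow> test" where
  "leaf_test \<sigma> e = conj_upto (\<lambda>c. Eq (Child e (Const c)) (Const 0)) \<sigma>"

definition no_weiner_test :: "nat \<Rightarrow> exp \<Rightarrow> test" where
  "no_weiner_test \<sigma> e = conj_upto (\<lambda>c. Eq (WeinerLink e (Const c)) (Const 0)) \<sigma>"

text \<open>A null child pointer causes a store at index 0, which is the address of no node.\<close>

primrec store_parents :: "nat \<Rightarrow> com" where
  "store_parents 0 = Skip"
| "store_parents (Suc j) = Seq (store_parents j) (Store 0 (Child (Reg 0) (Const j)) (Reg 0))"

definition overwrite :: "(nat \<Rightarrow> nat) \<Rightarrow> nat \<Rightarrow> nat \<Rightarrow> (nat \<Rightarrow> nat) \<Rightarrow> nat \<Rightarrow> nat" where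
  "overwrite f j v g w = (if \<exists>c<j. f c = w then v else g w)"

lemma overwrite_0: "overwrite f 0 v g = g"
  by (simp add: overwrite_def fun_eq_iff)

lemma overwrite_Suc: "(overwrite f j v g)(f j := v) = overwrite f (Suc j) v g"
  by (auto simp: overwrite_def fun_eq_iff less_Suc_eq)

lemma wp_store_parents:
  assumes "\<forall>c<j. child D (regs s 0) c \<le> W" "regs s 0 \<le> W"
    "Q (s\<lparr>arrs := (arrs s)(0 := overwrite (child D (regs s 0)) j (regs s 0) (arrs s 0))\<rparr>)"
  shows "wp W D (store_parents j) Q s"
  using assms
proof (induction j arbitrary: Q)
  case 0
  then show ?case by (simp add: overwrite_0)
next
  case (Suc j)
  show ?case
    using Suc.prems unfolding store_parents.simps wp.simps(5)
    by (intro Suc.IH) (simp_all add: overwrite_Suc fun_upd_same del: fun_upd_apply)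
qed

text \<open>One pass over the nodes fills in the parents, clears the counters of garbage, and puts
  the leaf of the whole text into register 1.\<close>

definition init_body :: "nat \<Rightarrow> com" where
  "init_body \<sigma> = Seq (store_parents \<sigma>) (Seq (Store 1 (Reg 0) (Const 0))
     (Seq (Cond (Conj (leaf_test \<sigma> (Reg 0)) (no_weiner_test \<sigma> (Reg 0))) (Assign 1 (Reg 0)) Skip)
       (Assign 0 (Add (Reg 0) (Const 1)))))"

definition nodes_test :: test where
  "nodes_test = Less (Reg 0) (Add IstSize (Const 1))"

text \<open>Index 0 carries the counter of the strings that are not nodes. The pass over the nodes
  skips it, so it is cleared here.\<close>

definition init_start :: com where
  "init_start = Seq (Store 1 (Const 0) (Const 0)) (Assign 0 (Const 1))"

definition record_net :: com where
  "record_net = Cond (Conj (Less (Const 0) (Reg 4)) (Neg (Less (Reg 4) (Reg 2))))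
     (Seq (Store 1 (Reg 5) (Add (Arr 1 (Reg 5)) (Const 1)))
       (Seq (Store 2 (Reg 5) (Reg 3)) (Store 3 (Reg 5) (Reg 4)))) Skip"

text \<open>With 0 as previous length, the comparison in \<open>record_net\<close> succeeds at the
  first start, which has no left neighbour.\<close>

definition scan_start :: com where
  "scan_start = Seq (Assign 2 (Const 0)) (Assign 3 (Const 0))"

text \<open>The scan ends at the longest repeated suffix. If that is no node, the suffix link to it
  is null.\<close>

definition scan_test :: "nat \<Rightarrow> test" where
  "scan_test \<sigma> = Conj (Neg (Eq (Reg 1) (Const 0))) (leaf_test \<sigma> (Reg 1))"

text \<open>The depth of the leaf minus the length of its edge label is the depth of the parent. If
  there are implicit nodes, the last offset is added to it and the string is not a node.\<close>

definition scan_locate :: com where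
  "scan_locate =
     Seq (Assign 4 (Sub (Sub TextLen (Reg 3))
       (Sub (Add (LabelEnd (Reg 1)) (Const 1)) (LabelStart (Reg 1)))))
     (Seq (Assign 5 (Arr 0 (Reg 1)))
       (Cond (Less (Const 0) (ImpCount (Reg 1)))
         (Seq (Assign 4 (Add (Reg 4) (ImpOffset (Reg 1) (Sub (ImpCount (Reg 1)) (Const 1)))))
           (Assign 5 (Const 0))) Skip))"

definition scan_next :: com where
  "scan_next = Seq (Assign 2 (Reg 4)) (Seq (Assign 3 (Add (Reg 3) (Const 1)))
     (Assign 1 (SuffixLink (Reg 1))))"

definition scan_body :: com where
  "scan_body = Seq scan_locate (Seq record_net scan_next)"

text \<open>The longest repeated suffix is its own longest repeated prefix, and register 1 already
  holds its address or 0. Register 0 is reset because the report includes index 0.\<close>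

definition scan_end :: com where
  "scan_end = Seq (Assign 4 (Sub TextLen (Reg 3))) (Seq (Assign 5 (Reg 1))
     (Seq record_net (Assign 0 (Const 0))))"

definition report_body :: com where
  "report_body = Seq (Cond (Less (Const 0) (Arr 1 (Reg 0)))
      (Emit (Add (Arr 2 (Reg 0)) (Const 1)) (Add (Arr 2 (Reg 0)) (Arr 3 (Reg 0))) (Arr 1 (Reg 0))) Skip)
    (Assign 0 (Add (Reg 0) (Const 1)))"

definition all_nf_program :: "nat \<Rightarrow> com" where
  "all_nf_program \<sigma> =
     Seq init_start (Seq (While nodes_test (init_body \<sigma>))
       (Seq scan_start (Seq (While (scan_test \<sigma>) scan_body)
         (Seq scan_end (While nodes_test report_body)))))"


subsection \<open>Execution on a suffix tree\<close>

text \<open>This fixes a witness \<open>lab\<close> of \<open>represents_ist\<close>. The bounds on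
  \<open>W\<close> leave room for a node counter one past the last address and for
  \<open>length T + 1\<close> net starts.\<close>

locale text_tree =
  fixes \<sigma> :: nat and T :: "nat list" and D :: ist and lab :: "nat \<Rightarrow> nat list" and W :: nat
  assumes T: "T \<noteq> []" and alphabet: "set T \<subseteq> {..<\<sigma>}"
    and text_len: "text_len D = length T"
    and bij: "bij_betw lab {1..ist_size D} (ist_nodes T)"
    and child: "\<And>v c. v \<in> {1..ist_size D} \<Longrightarrow> c < \<sigma> \<Longrightarrow>
      points_to lab (ist_size D) (\<lambda>V. ist_edge T (lab v) V \<and> V ! length (lab v) = c) (child D v c)"
    and suffix_link: "\<And>v. v \<in> {1..ist_size D} \<Longrightarrow>
      points_to lab (ist_size D) (\<lambda>P. \<exists>x. lab v = x # P) (suffix_link D v)"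
    and weiner_link: "\<And>v x. v \<in> {1..ist_size D} \<Longrightarrow> x < \<sigma> \<Longrightarrow>
      points_to lab (ist_size D) (\<lambda>P. P = x # lab v) (weiner_link D v x)"
    and label: "\<And>v U. v \<in> {1..ist_size D} \<Longrightarrow> ist_edge T U (lab v) \<Longrightarrow>
      1 \<le> label_start D v \<and> label_start D v \<le> label_end D v \<and> label_end D v \<le> length T \<and>
      U @ substr T (label_start D v) (label_end D v) = lab v \<and>
      map (imp_offset D v) [0..<imp_count D v] = sorted_list_of_set (implicit_offsets T U (lab v))"
    and W: "Suc (ist_size D) \<le> W" "Suc (length T) \<le> W"
begin

section \<open>Addresses, pointers and tests\<close>

abbreviation (input) nodes :: "nat set" where "nodes \<equiv> {1..ist_size D}"

text \<open>The default 0 makes \<open>addr\<close> agree with null pointers at strings that are not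
  nodes.\<close>

definition addr :: "nat list \<Rightarrow> nat" where
  "addr P = (if P \<in> ist_nodes T then inv_into nodes lab P else 0)"

lemma lab_node: "v \<in> nodes \<Longrightarrow> lab v \<in> ist_nodes T"
  using bij_betwE[OF bij] by blast

lemma addr_lab: "v \<in> nodes \<Longrightarrow> addr (lab v) = v"
  using inv_into_f_f[OF bij_betw_imp_inj_on[OF bij]] lab_node unfolding addr_def by presburger

lemma lab_addr: "P \<in> ist_nodes T \<Longrightarrow> addr P \<in> nodes \<and> lab (addr P) = P"
proof -
  assume P: "P \<in> ist_nodes T"
  then have "P \<in> lab ` nodes" using bij_betw_imp_surj_on[OF bij] by blast
  then show ?thesis
    using P inv_into_into[of P lab nodes] f_inv_into_f[of P lab nodes] unfolding addr_def by simp
qed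

lemma addr_eq_0: "addr P = 0 \<longleftrightarrow> P \<notin> ist_nodes T"
  using lab_addr[of P] addr_def[of P] by auto

lemma addr_le: "addr P \<le> ist_size D"
  using lab_addr[of P] addr_def[of P] by auto

lemma points_to_eq_addr: "points_to lab (ist_size D) (\<lambda>P. P = S) a \<Longrightarrow> a = addr S"
  using addr_lab[of a] lab_node lab_addr[of S] addr_eq_0[of S]
  by (cases "\<exists>v\<in>nodes. lab v = S") (auto simp: points_to_def)

lemma weiner_link_eq: "v \<in> nodes \<Longrightarrow> x < \<sigma> \<Longrightarrow> weiner_link D v x = addr (x # lab v)"
  by (rule points_to_eq_addr) (rule weiner_link)

lemma suffix_link_eq: "v \<in> nodes \<Longrightarrow> lab v = x # P \<Longrightarrow> suffix_link D v = addr P"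
  by (rule points_to_eq_addr) (use suffix_link[of v] in \<open>simp add: eq_commute[of P]\<close>)

lemma child_le: "v \<in> nodes \<Longrightarrow> c < \<sigma> \<Longrightarrow> child D v c \<le> ist_size D"
  using child[of v c] by (auto simp: points_to_def split: if_splits)

lemma child_edge:
  assumes "v \<in> nodes" "c < \<sigma>" "child D v c \<noteq> 0"
  shows "ist_edge T (lab v) (lab (child D v c))"
  using child[OF assms(1,2)] assms(3) by (auto simp: points_to_def split: if_splits)

lemma edge_child:
  assumes "ist_edge T (lab v) (lab w)" "v \<in> nodes" "w \<in> nodes"
  obtains c where "c < \<sigma>" "child D v c = w"
proof -
  let ?c = "lab w ! length (lab v)"
  have "strict_prefix (lab v) (lab w)" using assms(1) by (simp add: ist_edge_def)
  then have "?c \<in> set (lab w)" using prefix_length_less nth_mem by blast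
  then have c: "?c < \<sigma>"
    using trie_nodes_set[OF ist_nodes_trie[OF lab_node[OF assms(3)]]] alphabet by auto
  have "child D v ?c \<in> nodes \<and> ist_edge T (lab v) (lab (child D v ?c))
      \<and> lab (child D v ?c) ! length (lab v) = ?c"
    using child[OF assms(2) c] assms by (auto simp: points_to_def split: if_splits)
  then have "child D v ?c = w"
    using edge_child_unique[OF _ assms(1)] addr_lab assms(3) by metis
  with c that show thesis by blast
qed

lemma leaf_test_iff:
  assumes "eval_exp D s e \<in> nodes"
  shows "eval_test D s (leaf_test \<sigma> e) \<longleftrightarrow> trie_children T (lab (eval_exp D s e)) = {}"
proof -
  let ?v = "eval_exp D s e"
  have "(\<forall>c<\<sigma>. child D ?v c = 0) \<longleftrightarrow> trie_children T (lab ?v) = {}"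
  proof
    assume a: "\<forall>c<\<sigma>. child D ?v c = 0"
    show "trie_children T (lab ?v) = {}"
    proof (rule ccontr)
      assume "trie_children T (lab ?v) \<noteq> {}"
      then obtain V where V: "ist_edge T (lab ?v) V" using ex_child_edge lab_node[OF assms] by blast
      then have "V \<in> ist_nodes T" by (simp add: ist_edge_def)
      with V lab_addr obtain c where "c < \<sigma>" "child D ?v c = addr V"
        using edge_child[of ?v "addr V"] assms by metis
      with a addr_eq_0 \<open>V \<in> ist_nodes T\<close> show False by auto
    qed
  next
    assume a: "trie_children T (lab ?v) = {}"
    show "\<forall>c<\<sigma>. child D ?v c = 0"
    proof (rule ccontr)
      assume "\<not> (\<forall>c<\<sigma>. child D ?v c = 0)"
      then obtain c where "ist_edge T (lab ?v) (lab (child D ?v c))" using child_edge assms by blast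
      then have "lab (child D ?v c) \<in> trie_nodes T" "strict_prefix (lab ?v) (lab (child D ?v c))"
        using ist_nodes_trie by (auto simp: ist_edge_def)
      with a show False
        using trie_nodes_prefix strict_prefix_snocE by (fastforce simp: trie_children_def)
    qed
  qed
  then show ?thesis by (simp add: leaf_test_def)
qed

text \<open>Weiner links are tried only for letters below \<open>\<sigma>\<close>, which suffices
  since all letters of trie strings come from \<open>T\<close>.\<close>

lemma top_test_iff:
  assumes "eval_exp D s e \<in> nodes"
  shows "eval_test D s (leaf_test \<sigma> e) \<and> eval_test D s (no_weiner_test \<sigma> e)
    \<longleftrightarrow> lab (eval_exp D s e) = T"
proof -
  let ?v = "eval_exp D s e"
  have "x < \<sigma>" if "x # lab ?v \<in> ist_nodes T" for x
    using trie_nodes_set[OF ist_nodes_trie[OF that]] alphabet by auto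
  then have "eval_test D s (no_weiner_test \<sigma> e) \<longleftrightarrow> (\<forall>x. x # lab ?v \<notin> ist_nodes T)"
    using weiner_link_eq[OF assms] addr_eq_0 by (auto simp: no_weiner_test_def)
  moreover have "x \<in> set T" if "x # lab ?v \<in> ist_nodes T" for x
    using trie_nodes_set[OF ist_nodes_trie[OF that]] by auto
  ultimately show ?thesis
    using leaf_test_iff[OF assms] text_node_iff[OF T lab_node[OF assms]] by auto
qed

section \<open>Initialization of the working memory\<close>

text \<open>The property is indexed by upper ends, because the pass visits a node and stores into
  its children.\<close>

definition parents :: "nat \<Rightarrow> (nat \<Rightarrow> nat) \<Rightarrow> bool" where
  "parents k par \<longleftrightarrow> (\<forall>v\<in>nodes. v < k \<longrightarrow> (\<forall>c<\<sigma>. child D v c \<noteq> 0 \<longrightarrow> par (child D v c) = v))"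

lemma parents_edge:
  assumes "parents (Suc (ist_size D)) par" "ist_edge T U (lab w)" "w \<in> nodes"
  shows "par w = addr U"
proof -
  have "U \<in> ist_nodes T" using assms(2) by (simp add: ist_edge_def)
  then have u: "addr U \<in> nodes" "lab (addr U) = U" using lab_addr by auto
  then obtain c where c: "c < \<sigma>" "child D (addr U) c = w"
    using edge_child[of "addr U" w] assms(2,3) by metis
  have "w \<noteq> 0" "addr U < Suc (ist_size D)" using assms(3) u(1) by auto
  with assms(1) u(1) c show ?thesis unfolding parents_def by blast
qed

definition init_inv :: "state \<Rightarrow> bool" where
  "init_inv s \<longleftrightarrow> 1 \<le> regs s 0 \<and> regs s 0 \<le> Suc (ist_size D) \<and> emitted s = [] \<and>
     (\<forall>u<regs s 0. arrs s 1 u = 0) \<and> parents (regs s 0) (arrs s 0) \<and>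
     (addr T < regs s 0 \<longrightarrow> regs s 1 = addr T)"

lemma text_node: "T \<in> ist_nodes T"
  using drop_is_leaf[of T 0] not_repeated_text[OF T] drop_in_trie_nodes[of 0 T]
  by (simp add: ist_nodes_def)

lemma init_body:
  assumes "init_inv s" "eval_test D s nodes_test"
  shows "wp W D (init_body \<sigma>)
    (\<lambda>s'. init_inv s' \<and> Suc (ist_size D) - regs s' 0 < Suc (ist_size D) - regs s 0) s"
proof -
  define v where "v = regs s 0"
  have v: "v \<in> nodes" and vs: "regs s 0 = v"
    using assms by (auto simp: init_inv_def nodes_test_def v_def)
  let ?par = "overwrite (child D v) \<sigma> v (arrs s 0)"
  have par: "parents (Suc v) ?par"
    unfolding parents_def
  proof (intro ballI impI allI)
    fix u c assume u: "u \<in> nodes" "u < Suc v" "c < \<sigma>" "child D u c \<noteq> 0"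
    show "?par (child D u c) = u"
    proof (cases "\<exists>d<\<sigma>. child D v d = child D u c")
      case True
      then obtain d where "d < \<sigma>" "child D v d = child D u c" by blast
      \<comment> \<open>An entry written earlier and overwritten now would belong to a node with two
        parents.\<close>
      then have "lab u = lab v"
        using child_edge[of u c] child_edge[of v d] u v edge_parent_unique by metis
      then have "u = v" using addr_lab u v by metis
      with True show ?thesis by (auto simp: overwrite_def)
    next
      case False
      with u have "u < v" by (metis less_SucE)
      with False u assms(1) vs show ?thesis by (auto simp: init_inv_def parents_def overwrite_def)
    qed
  qed
  have top: "lab v = T \<longleftrightarrow> addr T = v"
    using addr_lab[OF v] lab_addr[OF text_node] by auto
  show ?thesis
    unfolding init_body_def wp.simps(5)
  proof (rule wp_store_parents, goal_cases)
    case 1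
    then show ?case using child_le v vs W by (meson le_SucI le_trans)
  next
    case 2
    then show ?case using v vs W by simp
  next
    case 3
    define s1 where "s1 = s\<lparr>arrs := (arrs s)(0 := ?par)\<rparr>"
    define s2 where "s2 = s1\<lparr>arrs := (arrs s1)(1 := (arrs s1 1)(v := 0))\<rparr>"
    have s2: "regs s2 = regs s" "emitted s2 = emitted s" "arrs s2 0 = ?par"
      "arrs s2 1 = (arrs s 1)(v := 0)"
      by (simp_all add: s2_def s1_def)
    have "wp W D (Cond (Conj (leaf_test \<sigma> (Reg 0)) (no_weiner_test \<sigma> (Reg 0))) (Assign 1 (Reg 0)) Skip)
      (wp W D (Assign 0 (Add (Reg 0) (Const 1)))
        (\<lambda>s'. init_inv s' \<and> Suc (ist_size D) - regs s' 0 < Suc (ist_size D) - regs s 0)) s2"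
      using assms(1) v W vs top_test_iff[of s2 "Reg 0"] top par[unfolded Suc_eq_plus1]
      by (auto simp: init_inv_def s2 less_Suc_eq simp del: One_nat_def)
    then show ?case
      using v W vs by (simp add: s2_def s1_def)
  qed
qed

section \<open>Counting net starts by address\<close>

definition prev_len :: "nat \<Rightarrow> nat" where
  "prev_len k = (if k = 0 then 0 else rep_len T (k - 1))"

text \<open>A positive length forces \<open>k < length T\<close>, and the default of
  \<open>prev_len\<close> absorbs the case \<open>k = 0\<close>. The result is the test made by
  \<open>record_net\<close>.\<close>

lemma net_start_iff: "net_start T k \<longleftrightarrow> 0 < rep_len T k \<and> prev_len k \<le> rep_len T k"
  using rep_len_props(1)[OF T, of k] by (auto simp: net_start_def prev_len_def)

definition starts :: "nat \<Rightarrow> nat \<Rightarrow> nat set" where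
  "starts m u = {k. k < m \<and> net_start T k \<and> addr (rep_str T k) = u}"

text \<open>Arrays 2 and 3 may still hold garbage where the counter is 0, so they are constrained
  only elsewhere. The range includes index 0.\<close>

definition tables :: "nat \<Rightarrow> (nat \<Rightarrow> nat \<Rightarrow> nat) \<Rightarrow> bool" where
  "tables m A \<longleftrightarrow> (\<forall>u\<le>ist_size D. A 1 u = card (starts m u) \<and>
     (A 1 u > 0 \<longrightarrow> A 2 u \<in> starts m u \<and> A 3 u = rep_len T (A 2 u)))"

lemma finite_starts [simp]: "finite (starts m u)"
  by (rule finite_subset[of _ "{..<m}"]) (auto simp: starts_def)

lemma card_starts_le: "card (starts m u) \<le> m"
  using card_mono[of "{..<m}" "starts m u"] by (auto simp: starts_def)

lemma starts_Suc:
  "starts (Suc m) u = (if net_start T m \<and> addr (rep_str T m) = u then insert m (starts m u) else starts m u)"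
  by (auto simp: starts_def less_Suc_eq)

lemma record_net:
  assumes "tables m (arrs s)" "regs s 3 = m" "regs s 4 = rep_len T m"
    "regs s 5 = addr (rep_str T m)" "regs s 2 = prev_len m" "m \<le> length T"
    "\<And>A. tables (Suc m) A \<Longrightarrow> A 0 = arrs s 0 \<Longrightarrow> Q (s\<lparr>arrs := A\<rparr>)"
  shows "wp W D record_net Q s"
proof (cases "net_start T m")
  case True
  let ?u = "addr (rep_str T m)"
  let ?A = "(arrs s)(1 := (arrs s 1)(?u := Suc (arrs s 1 ?u)), 2 := (arrs s 2)(?u := m),
    3 := (arrs s 3)(?u := rep_len T m))"
  have u: "?u \<le> ist_size D" by (rule addr_le)
  have "m \<notin> starts m u" for u by (simp add: starts_def)
  then have "tables (Suc m) ?A"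
    using assms(1) True by (auto simp: tables_def starts_Suc)
  from assms(7)[OF this] have "Q (s\<lparr>arrs := ?A\<rparr>)" by simp
  moreover have "Suc (arrs s 1 ?u) \<le> W"
    using assms(1,6) u W card_starts_le[of m ?u] by (auto simp: tables_def)
  moreover have "rep_len T m \<le> W" "m \<le> W" "?u \<le> W"
    using rep_len_props(1)[OF T, of m] W assms(6) u by auto
  ultimately show ?thesis
    using True assms(2-5) by (simp add: record_net_def net_start_iff)
next
  case False
  then have "tables (Suc m) (arrs s)"
    using assms(1) by (auto simp: tables_def starts_Suc)
  from assms(7)[OF this] have "Q s" by simp
  then show ?thesis
    using False assms(2-5) by (auto simp: record_net_def net_start_iff)
qed

section \<open>The scan along the leaves\<close>

text \<open>Since the empty suffix is repeated, the least value exists. It is the start of the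
  longest repeated suffix, and the leaves are the suffixes that start before it.\<close>

definition num_leaves :: nat where
  "num_leaves = (LEAST m. repeated T (drop m T))"

lemma num_leaves:
  "num_leaves \<le> length T" "repeated T (drop num_leaves T)"
  "k < num_leaves \<Longrightarrow> \<not> repeated T (drop k T)"
proof -
  have r: "repeated T (drop (length T) T)" using repeated_Nil[OF T] by simp
  then show "num_leaves \<le> length T" unfolding num_leaves_def by (rule Least_le)
  from r show "repeated T (drop num_leaves T)" unfolding num_leaves_def by (rule LeastI)
  show "k < num_leaves \<Longrightarrow> \<not> repeated T (drop k T)" unfolding num_leaves_def by (rule not_less_Least)
qed

definition scan_inv :: "state \<Rightarrow> bool" where
  "scan_inv s \<longleftrightarrow> regs s 3 \<le> num_leaves \<and> regs s 1 = addr (drop (regs s 3) T) \<and>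
     regs s 2 = prev_len (regs s 3) \<and> tables (regs s 3) (arrs s) \<and>
     parents (Suc (ist_size D)) (arrs s 0) \<and> emitted s = []"

lemma leaf_node:
  assumes "k < num_leaves"
  shows "drop k T \<in> ist_nodes T" "trie_children T (drop k T) = {}" "drop k T \<noteq> []"
proof -
  have k: "k < length T" "\<not> repeated T (drop k T)" using assms num_leaves by auto
  then show "trie_children T (drop k T) = {}" "drop k T \<noteq> []" using drop_is_leaf by auto
  then show "drop k T \<in> ist_nodes T" by (simp add: ist_nodes_def)
qed

text \<open>At \<open>num_leaves\<close> the suffix is a node with children or no node at all;
  either way one conjunct fails.\<close>

lemma scan_test_iff:
  assumes "scan_inv s"
  shows "eval_test D s (scan_test \<sigma>) \<longleftrightarrow> regs s 3 < num_leaves"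
proof -
  define k where "k = regs s 3"
  have k: "k \<le> num_leaves" "regs s 1 = addr (drop k T)" using assms by (auto simp: scan_inv_def k_def)
  show ?thesis
  proof (cases "drop k T \<in> ist_nodes T")
    case True
    then have "eval_test D s (scan_test \<sigma>) \<longleftrightarrow> trie_children T (drop k T) = {}"
      using lab_addr[OF True] leaf_test_iff[of s "Reg 1"] k by (auto simp: scan_test_def)
    moreover have "\<dots> \<longleftrightarrow> k < num_leaves"
      using leaf_iff[of k T] k(1) num_leaves by (metis le_neq_implies_less le_trans)
    ultimately show ?thesis by (simp add: k_def)
  next
    case False
    then have "regs s 1 = 0" "\<not> k < num_leaves" using leaf_node(1)[of k] k(2) addr_eq_0 by auto
    then show ?thesis by (simp add: scan_test_def k_def)
  qed
qed

text \<open>This rephrases \<open>rep_len_leaf\<close> in terms of what the program reads: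
  \<open>d\<close> is the depth of the parent, and in the increasing list of offsets the last is the
  maximum.\<close>

lemma leaf_edge:
  assumes k: "k < num_leaves" and par: "parents (Suc (ist_size D)) par"
  defines "v \<equiv> addr (drop k T)"
  defines "d \<equiv> length T - k - (label_end D v + 1 - label_start D v)"
  shows "rep_len T k = (if imp_count D v = 0 then d else d + imp_offset D v (imp_count D v - 1))"
    and "addr (rep_str T k) = (if imp_count D v = 0 then par v else 0)"
proof -
  have kn: "k \<le> length T" and nr: "\<not> repeated T (drop k T)" using k num_leaves by auto
  have v: "v \<in> nodes" "lab v = drop k T" using lab_addr leaf_node(1)[OF k] by (auto simp: v_def)
  obtain U where e: "ist_edge T U (lab v)" using ex_parent_edge leaf_node[OF k] v by metis
  let ?A = "implicit_offsets T U (drop k T)"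
  note l = label[OF v(1) e]
  note r = rep_len_leaf[OF T kn nr e[unfolded v(2)]]
  have "length (lab v) = length U + length (substr T (label_start D v) (label_end D v))"
    using l by (metis length_append)
  also have "length (substr T (label_start D v) (label_end D v)) = label_end D v + 1 - label_start D v"
    using l by (auto simp: substr_def min_def)
  finally have d: "d = length U" using v by (simp add: d_def)
  have "set (map (imp_offset D v) [0..<imp_count D v]) = ?A"
    using l r(4) v by simp
  then have emp: "?A = {} \<longleftrightarrow> imp_count D v = 0" by auto
  show "addr (rep_str T k) = (if imp_count D v = 0 then par v else 0)"
    using r(2,3) parents_edge[OF par e v(1)] emp addr_eq_0 by auto
  have "Max ?A = imp_offset D v (imp_count D v - 1)" if c: "imp_count D v > 0"
  proof -
    let ?l = "map (imp_offset D v) [0..<imp_count D v]"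
    have sl: "sorted ?l" "set ?l = ?A" using l r(4) v by simp_all
    show ?thesis
    proof (rule Max_eqI[OF r(4)])
      show "imp_offset D v (imp_count D v - 1) \<in> ?A" using sl(2) c by auto
      fix a assume "a \<in> ?A"
      then obtain i where i: "i < imp_count D v" "a = imp_offset D v i" unfolding sl(2)[symmetric] by auto
      then show "a \<le> imp_offset D v (imp_count D v - 1)"
        using sorted_nth_mono[OF sl(1), of i "imp_count D v - 1"] by simp
    qed
  qed
  then show "rep_len T k = (if imp_count D v = 0 then d else d + imp_offset D v (imp_count D v - 1))"
    using r(1) emp d by auto
qed

lemma scan_body:
  assumes inv: "scan_inv s" and test: "eval_test D s (scan_test \<sigma>)"
  shows "wp W D scan_body (\<lambda>s'. scan_inv s' \<and> length T - regs s' 3 < length T - regs s 3) s"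
proof -
  define k where "k = regs s 3"
  have k: "k < num_leaves" using test scan_test_iff[OF inv] by (simp add: k_def)
  then have kn: "k < length T" using num_leaves(1) by simp
  let ?v = "addr (drop k T)"
  have v: "?v \<in> nodes" "lab ?v = drop k T" using lab_addr leaf_node(1)[OF k] by auto
  have s: "regs s 1 = ?v" "regs s 2 = prev_len k" "tables k (arrs s)"
    "parents (Suc (ist_size D)) (arrs s 0)" "emitted s = []" "regs s 3 = k"
    using inv by (auto simp: scan_inv_def k_def)
  note le = leaf_edge[OF k s(4)]
  have suf: "suffix_link D ?v = addr (drop (Suc k) T)"
    using suffix_link_eq[OF v(1)] v(2) Cons_nth_drop_Suc[OF kn] by metis
  have bounds: "rep_len T k \<le> W" "addr P \<le> W" "Suc k \<le> W" for P
    using rep_len_props(1)[OF T, of k] addr_le[of P] W kn by auto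
  have loc: "wp W D scan_locate Q s"
    if "\<And>g. g 4 = rep_len T k \<Longrightarrow> g 5 = addr (rep_str T k) \<Longrightarrow> \<forall>i\<in>{1,2,3}. g i = regs s i
      \<Longrightarrow> Q (s\<lparr>regs := g\<rparr>)" for Q
  proof (cases "imp_count D ?v = 0")
    case True
    with le have le': "rep_len T k = length T - k - (label_end D ?v + 1 - label_start D ?v)"
      "addr (rep_str T k) = arrs s 0 ?v" by simp_all
    show ?thesis
      using True bounds(1) bounds(2)[of "rep_str T k"]
      by (auto simp: scan_locate_def s text_len le' simp del: One_nat_def intro!: that)
  next
    case False
    with le have le': "rep_len T k = length T - k - (label_end D ?v + 1 - label_start D ?v)
        + imp_offset D ?v (imp_count D ?v - 1)"
      "addr (rep_str T k) = 0" by simp_all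
    \<comment> \<open>Register 5 receives the parent before it is reset to 0, so the parent must fit
      into a word here too.\<close>
    obtain U where "ist_edge T U (lab ?v)" using ex_parent_edge leaf_node[OF k] v by metis
    from parents_edge[OF s(4) this v(1)] have "arrs s 0 ?v \<le> W" using bounds(2) by simp
    then show ?thesis
      using False bounds(1)
      by (auto simp: scan_locate_def s text_len le' simp del: One_nat_def intro!: that)
  qed
  show ?thesis
    unfolding scan_body_def wp.simps(5)
  proof (rule loc, rule record_net[where m = k], goal_cases)
    case (7 g A)
    then show ?case
      using s suf bounds k kn by (simp add: scan_next_def scan_inv_def prev_len_def)
  qed (use s kn in auto)
qed

section \<open>Correctness of the report\<close>

text \<open>Address 0 is the only one shared by several strings, and net strings with that address
  all equal the longest repeated suffix.\<close>

lemma addr_rep_str_eq_iff: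
  assumes "net_start T k" "net_start T j"
  shows "addr (rep_str T k) = addr (rep_str T j) \<longleftrightarrow> rep_str T k = rep_str T j"
proof
  assume eq: "addr (rep_str T k) = addr (rep_str T j)"
  show "rep_str T k = rep_str T j"
  proof (cases "rep_str T k \<in> ist_nodes T")
    case True
    with eq have "rep_str T j \<in> ist_nodes T" using addr_eq_0 by metis
    with True eq show ?thesis using lab_addr by metis
  next
    case False
    with eq have "rep_str T j \<notin> ist_nodes T" using addr_eq_0 by metis
    with False show ?thesis
      using net_not_node_eq_longest_repeated_suffix[OF T] assms num_leaves by metis
  qed
qed simp

text \<open>Beyond the longest repeated suffix \<open>L\<close> decreases by one at each start, so
  the scan misses no net start.\<close>

lemma net_start_le: "net_start T k \<Longrightarrow> k \<le> num_leaves"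
proof (rule ccontr)
  assume net: "net_start T k" and "\<not> k \<le> num_leaves"
  then have k: "k > num_leaves" "k < length T" by (auto simp: net_start_def)
  have "repeated T (drop k T)" "repeated T (drop (k - 1) T)"
    using k num_leaves(2) by (auto intro: repeated_drop_mono)
  then have "rep_len T k = length T - k" "rep_len T (k - 1) = length T - (k - 1)"
    using rep_len_repeated_suffix[OF T] by auto
  with net k show False by (auto simp: net_start_def)
qed

definition report :: "(nat \<Rightarrow> nat \<Rightarrow> nat) \<Rightarrow> nat \<Rightarrow> (nat \<times> nat \<times> nat) list" where
  "report A m = map (\<lambda>u. (A 2 u + 1, A 2 u + A 3 u, A 1 u)) (filter (\<lambda>u. A 1 u > 0) [0..<m])"

text \<open>Among net strings addresses are unambiguous, so the counter of an address is the net
  frequency of its string.\<close>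

lemma all_nf_report:
  assumes "tables (Suc num_leaves) A"
  shows "all_nf_output T (report A (Suc (ist_size D)))"
proof -
  let ?N = "Suc (ist_size D)"
  define us where "us = filter (\<lambda>u. A 1 u > 0) [0..<?N]"
  have us_iff: "u \<in> set us \<longleftrightarrow> u \<le> ist_size D \<and> A 1 u > 0" for u
    by (auto simp: us_def simp del: upt_Suc)
  have starts: "starts (Suc num_leaves) u = {k. net_start T k \<and> addr (rep_str T k) = u}" for u
    using net_start_le by (auto simp: starts_def less_Suc_eq_le)
  have us: "net_start T (A 2 u)" "addr (rep_str T (A 2 u)) = u" "A 3 u = rep_len T (A 2 u)"
    "A 1 u = card {k. net_start T k \<and> addr (rep_str T k) = u}" if "u \<in> set us" for u
  proof -
    from that have "u \<le> ist_size D" "A 1 u > 0" by (auto simp: us_iff)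
    with assms have "A 1 u = card (starts (Suc num_leaves) u)" "A 2 u \<in> starts (Suc num_leaves) u"
      "A 3 u = rep_len T (A 2 u)" by (auto simp: tables_def)
    then show "net_start T (A 2 u)" "addr (rep_str T (A 2 u)) = u" "A 3 u = rep_len T (A 2 u)"
      "A 1 u = card {k. net_start T k \<and> addr (rep_str T k) = u}"
      by (auto simp: starts)
  qed
  have str: "substr T (A 2 u + 1) (A 2 u + A 3 u) = rep_str T (A 2 u)" if "u \<in> set us" for u
    using us(3)[OF that] substr_Suc by (simp add: rep_str_def)
  have nf: "net_freq T (rep_str T (A 2 u)) = A 1 u" if u: "u \<in> set us" for u
  proof -
    have "{k. net_start T k \<and> rep_str T k = rep_str T (A 2 u)}
        = {k. net_start T k \<and> addr (rep_str T k) = u}"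
      using us(2)[OF u] addr_rep_str_eq_iff us(1)[OF u] by metis
    with us(4)[OF u] show ?thesis by (simp add: net_freq_eq[OF T])
  qed
  have rep: "report A ?N = map (\<lambda>u. (A 2 u + 1, A 2 u + A 3 u, A 1 u)) us"
    by (simp add: report_def us_def)
  have map_eq: "map (\<lambda>(i, j, \<phi>). substr T i j) (report A ?N) = map (\<lambda>u. rep_str T (A 2 u)) us"
    using str by (simp add: rep)
  \<comment> \<open>By \<open>us(2)\<close> the address can be recovered from the string.\<close>
  have "inj_on (\<lambda>u. rep_str T (A 2 u)) (set us)"
    using us(2) by (metis (no_types, lifting) inj_onI)
  then have dist: "distinct (map (\<lambda>u. rep_str T (A 2 u)) us)"
    by (simp add: distinct_map us_def del: upt_Suc)
  have "(\<lambda>u. rep_str T (A 2 u)) ` set us = {S. net_freq T S > 0}"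
  proof (intro equalityI subsetI)
    fix S assume "S \<in> (\<lambda>u. rep_str T (A 2 u)) ` set us"
    then obtain u where u: "u \<in> set us" "S = rep_str T (A 2 u)" by blast
    then have "A 1 u > 0" by (simp add: us_iff)
    with u nf show "S \<in> {S. net_freq T S > 0}" by simp
  next
    fix S assume "S \<in> {S. net_freq T S > 0}"
    then obtain k where k: "net_start T k" "rep_str T k = S"
      by (auto simp: net_freq_eq[OF T] card_gt_0_iff)
    let ?u = "addr S"
    have "k \<in> starts (Suc num_leaves) ?u" using k by (simp add: starts)
    then have "card (starts (Suc num_leaves) ?u) > 0" by (auto simp: card_gt_0_iff)
    then have "?u \<in> set us" using addr_le[of S] assms by (simp add: us_iff tables_def)
    moreover from this have "rep_str T (A 2 ?u) = S"
      using addr_rep_str_eq_iff[OF us(1)[of ?u] k(1)] us(2)[of ?u] k(2) by simp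
    ultimately show "S \<in> (\<lambda>u. rep_str T (A 2 u)) ` set us" by force
  qed
  moreover have "(\<lambda>(i, j, \<phi>). substr T i j) ` set (report A ?N) = (\<lambda>u. rep_str T (A 2 u)) ` set us"
    using arg_cong[OF map_eq, of set] by (simp only: set_map)
  moreover have "\<forall>(i, j, \<phi>)\<in>set (report A ?N). 1 \<le> i \<and> i \<le> j \<and> j \<le> length T \<and> \<phi> = net_freq T (substr T i j)"
  proof -
    have "A 2 u + 1 \<le> A 2 u + A 3 u \<and> A 2 u + A 3 u \<le> length T \<and>
        A 1 u = net_freq T (substr T (A 2 u + 1) (A 2 u + A 3 u))" if u: "u \<in> set us" for u
      using us(1,3)[OF u] rep_len_props(1)[OF T, of "A 2 u"] str[OF u] nf[OF u]
      by (auto simp: net_start_def)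
    then show ?thesis by (auto simp: rep)
  qed
  ultimately show ?thesis
    using dist unfolding all_nf_output_def map_eq by simp
qed

section \<open>The complete run and its linear time bound\<close>

lemma all_nf_program:
  fixes s :: state
  assumes "emitted s = []"
  defines "n \<equiv> length T" and "N \<equiv> ist_size D"
  shows "runs W D (all_nf_program \<sigma>) s
    (time init_start + (Suc N * (1 + test_cost nodes_test + time (init_body \<sigma>))
     + (time scan_start + (Suc n * (1 + test_cost (scan_test \<sigma>) + time scan_body)
     + (time scan_end + Suc (Suc N) * (1 + test_cost nodes_test + time report_body))))))
    (\<lambda>s'. all_nf_output T (emitted s'))"
  unfolding all_nf_program_def
proof (rule runs_seq)
  let ?I = "\<lambda>s. init_inv s \<and> regs s 0 = 1"
  have "wp W D init_start ?I s"
    using assms(1) W addr_eq_0[of T] text_node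
    by (simp add: init_start_def init_inv_def parents_def)
  then show "runs W D init_start s (time init_start) ?I" by (rule runs_wp)
next
  fix s1 assume s1: "init_inv s1 \<and> regs s1 0 = 1"
  let ?J = "\<lambda>s. init_inv s \<and> \<not> eval_test D s nodes_test"
  show "runs W D (Seq (While nodes_test (init_body \<sigma>)) (Seq scan_start (Seq (While (scan_test \<sigma>) scan_body)
      (Seq scan_end (While nodes_test report_body))))) s1
    (Suc N * (1 + test_cost nodes_test + time (init_body \<sigma>))
     + (time scan_start + (Suc n * (1 + test_cost (scan_test \<sigma>) + time scan_body)
     + (time scan_end + Suc (Suc N) * (1 + test_cost nodes_test + time report_body)))))
    (\<lambda>s'. all_nf_output T (emitted s'))"
  proof (rule runs_seq)
    show "runs W D (While nodes_test (init_body \<sigma>)) s1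
        (Suc N * (1 + test_cost nodes_test + time (init_body \<sigma>))) ?J"
      using runs_while[of init_inv D nodes_test W "init_body \<sigma>" "\<lambda>s. Suc (ist_size D) - regs s 0" s1]
        init_body s1 by (simp add: N_def)
  next
    fix s2 assume "?J s2"
    then have s2: "regs s2 0 = Suc (ist_size D)" "init_inv s2"
      by (auto simp: init_inv_def nodes_test_def)
    let ?K = "\<lambda>s. scan_inv s \<and> regs s 3 = 0"
    show "runs W D (Seq scan_start (Seq (While (scan_test \<sigma>) scan_body)
        (Seq scan_end (While nodes_test report_body)))) s2
      (time scan_start + (Suc n * (1 + test_cost (scan_test \<sigma>) + time scan_body)
       + (time scan_end + Suc (Suc N) * (1 + test_cost nodes_test + time report_body))))
      (\<lambda>s'. all_nf_output T (emitted s'))"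
    proof (rule runs_seq)
      have "starts 0 u = {}" for u by (simp add: starts_def)
      then have "wp W D scan_start ?K s2"
        using s2 addr_le[of T]
        by (simp add: scan_start_def scan_inv_def init_inv_def prev_len_def tables_def less_Suc_eq_le)
      then show "runs W D scan_start s2 (time scan_start) ?K" by (rule runs_wp)
    next
      fix s3 assume s3: "?K s3"
      let ?L = "\<lambda>s. scan_inv s \<and> \<not> eval_test D s (scan_test \<sigma>)"
      show "runs W D (Seq (While (scan_test \<sigma>) scan_body) (Seq scan_end (While nodes_test report_body))) s3
        (Suc n * (1 + test_cost (scan_test \<sigma>) + time scan_body)
         + (time scan_end + Suc (Suc N) * (1 + test_cost nodes_test + time report_body)))
        (\<lambda>s'. all_nf_output T (emitted s'))"
      proof (rule runs_seq)
        show "runs W D (While (scan_test \<sigma>) scan_body) s3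
            (Suc n * (1 + test_cost (scan_test \<sigma>) + time scan_body)) ?L"
          using runs_while[of scan_inv D "scan_test \<sigma>" W scan_body "\<lambda>s. length T - regs s 3" s3]
            scan_body s3 by (simp add: n_def)
      next
        fix s4 assume "?L s4"
        then have s4: "regs s4 3 = num_leaves" "scan_inv s4"
          using scan_test_iff[of s4] by (auto simp: scan_inv_def)
        let ?M = "\<lambda>s :: state. tables (Suc num_leaves) (arrs s) \<and> emitted s = [] \<and> regs s 0 = 0"
        show "runs W D (Seq scan_end (While nodes_test report_body)) s4
          (time scan_end + Suc (Suc N) * (1 + test_cost nodes_test + time report_body))
          (\<lambda>s'. all_nf_output T (emitted s'))"
        proof (rule runs_seq)
          have r: "rep_len T num_leaves = length T - num_leaves"
            "rep_str T num_leaves = drop num_leaves T"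
            using rep_len_repeated_suffix[OF T num_leaves(2)] by (auto simp: rep_str_def)
          have i: "regs s4 1 = addr (drop num_leaves T)" "regs s4 2 = prev_len num_leaves"
            "tables num_leaves (arrs s4)" "emitted s4 = []"
            using s4 by (auto simp: scan_inv_def)
          have "length T - num_leaves \<le> W" "addr (drop num_leaves T) \<le> W"
            using W addr_le[of "drop num_leaves T"] by auto
          then have "wp W D scan_end ?M s4"
            unfolding scan_end_def
            using i r s4 num_leaves(1) by (auto simp: text_len intro!: record_net[where m = num_leaves])
          then show "runs W D scan_end s4 (time scan_end) ?M" by (rule runs_wp)
        next
          fix s5 assume s5: "?M s5"
          define A where "A = arrs s5"
          \<comment> \<open>The loop starts at index 0, so it makes one round more than there are
            nodes.\<close>
          let ?R = "\<lambda>s :: state. arrs s = A \<and> regs s 0 \<le> Suc (ist_size D) \<and> emitted s = report A (regs s 0)"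
          have body: "wp W D report_body (\<lambda>s'. ?R s' \<and> Suc (ist_size D) - regs s' 0 < Suc (ist_size D) - regs s 0) s"
            if "?R s" "eval_test D s nodes_test" for s
            using that W by (auto simp: report_body_def nodes_test_def report_def)
          have "?R s5" using s5 by (simp add: A_def report_def)
          note while = runs_while[of ?R D nodes_test W report_body "\<lambda>s. Suc (ist_size D) - regs s 0" s5,
              OF body this]
          have out: "all_nf_output T (emitted s)" if "?R s \<and> \<not> eval_test D s nodes_test" for s
          proof -
            from that have "emitted s = report A (Suc (ist_size D))"
              by (auto simp: nodes_test_def le_Suc_eq)
            with all_nf_report[of A] s5 show ?thesis by (simp add: A_def)
          qed
          show "runs W D (While nodes_test report_body) s5
              (Suc (Suc N) * (1 + test_cost nodes_test + time report_body))
              (\<lambda>s'. all_nf_output T (emitted s'))"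
            by (rule runs_mono[OF while _ out]) (use s5 in \<open>auto simp: N_def\<close>)
        qed
      qed
    qed
  qed
qed

end

theorem theorem4:
  fixes \<sigma> :: nat
  shows "\<exists>(p :: com) (C :: nat).
    \<forall>w :: nat \<Rightarrow> nat. (\<forall>i. w i < \<sigma>) \<longrightarrow>
      (\<forall>n \<ge> 1. \<forall>D. represents_ist \<sigma> (map w [0..<n]) D \<longrightarrow>
         solves_all_nf_within (C * n) (C * n) p (map w [0..<n]) D)"
proof -
  define a where "a = time init_start + time scan_start + time scan_end"
  define b where "b = 1 + test_cost nodes_test + time (init_body \<sigma>)"
  define c where "c = 1 + test_cost (scan_test \<sigma>) + time scan_body"
  define d where "d = 1 + test_cost nodes_test + time report_body"
  \<comment> \<open>For \<open>n \<ge> 1\<close> and at most \<open>2 * n + 3\<close> nodes, the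
    factors \<open>Suc N\<close>, \<open>Suc n\<close> and \<open>Suc (Suc N)\<close> of the loop
    costs are at most \<open>6 * n\<close>, \<open>2 * n\<close> and \<open>7 * n\<close>.\<close>
  define C where "C = a + 6 * b + 2 * c + 7 * d"
  have "solves_all_nf_within (C * n) (C * n) (all_nf_program \<sigma>) (map w [0..<n]) D"
    if w: "\<forall>i. w i < \<sigma>" and n: "n \<ge> 1" and D: "represents_ist \<sigma> (map w [0..<n]) D" for w n D
  proof -
    let ?T = "map w [0..<n]"
    obtain lab where lab: "bij_betw lab {1..ist_size D} (ist_nodes ?T)"
      "\<forall>v \<in> {1..ist_size D}.
           (\<forall>c < \<sigma>. points_to lab (ist_size D)
                (\<lambda>V. ist_edge ?T (lab v) V \<and> V ! length (lab v) = c) (child D v c)) \<and>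
           points_to lab (ist_size D) (\<lambda>P. \<exists>x. lab v = x # P) (suffix_link D v) \<and>
           (\<forall>x < \<sigma>. points_to lab (ist_size D) (\<lambda>P. P = x # lab v) (weiner_link D v x)) \<and>
           (\<forall>U. ist_edge ?T U (lab v) \<longrightarrow>
              1 \<le> label_start D v \<and> label_start D v \<le> label_end D v \<and> label_end D v \<le> length ?T \<and>
              U @ substr ?T (label_start D v) (label_end D v) = lab v \<and>
              map (imp_offset D v) [0..<imp_count D v]
                = sorted_list_of_set (implicit_offsets ?T U (lab v)))"
      using D unfolding represents_ist_def by blast
    have len: "text_len D = length ?T" using D by (simp add: represents_ist_def)
    have "ist_size D = card (ist_nodes ?T)" using bij_betw_same_card[OF lab(1)] by simp
    then have N: "ist_size D \<le> 2 * n + 3" using card_ist_nodes[of ?T] by simp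
    \<comment> \<open>The time bound \<open>C * n\<close> also serves as word bound;
      \<open>C \<ge> 6\<close> makes it large enough for addresses and positions.\<close>
    have "b \<ge> 1" "d \<ge> 1" by (auto simp: b_def d_def)
    then have "6 * n \<le> C * n" by (simp add: C_def)
    then have "Suc (ist_size D) \<le> C * n" "Suc n \<le> C * n" using N n by linarith+
    then have W: "Suc (ist_size D) \<le> C * n" "Suc (length ?T) \<le> C * n" by simp_all
    have ne: "?T \<noteq> []" "set ?T \<subseteq> {..<\<sigma>}" using w n by auto
    interpret text_tree \<sigma> ?T D lab "C * n"
      by (rule text_tree.intro[OF ne len lab(1) _ _ _ _ W]) (drule lab(2)[THEN bspec]; elim conjE; simp)+
    have bound: "time init_start + (Suc (ist_size D) * b + (time scan_start + (Suc n * c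
        + (time scan_end + Suc (Suc (ist_size D)) * d)))) \<le> C * n"
    proof -
      have "Suc (ist_size D) * b \<le> 6 * n * b" "Suc n * c \<le> 2 * n * c" "Suc (Suc (ist_size D)) * d \<le> 7 * n * d"
        using N n by (intro mult_le_mono1; simp)+
      moreover have "a \<le> a * n" using n by simp
      moreover have "C * n = a * n + 6 * n * b + 2 * n * c + 7 * n * d"
        by (simp add: C_def algebra_simps)
      ultimately have "a + Suc (ist_size D) * b + Suc n * c + Suc (Suc (ist_size D)) * d \<le> C * n"
        by linarith
      then show ?thesis by (simp add: a_def)
    qed
    show ?thesis
      unfolding solves_all_nf_within_def
    proof (intro allI impI)
      fix s :: state assume "emitted s = []"
      from runs_mono[OF all_nf_program[OF this] _, of "C * n"] bound
      show "\<exists>t s'. exec (C * n) D (all_nf_program \<sigma>) s t s' \<and> t \<le> C * n \<and> all_nf_output ?T (emitted s')"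
        by (auto simp: runs_def b_def c_def d_def)
    qed
  qed
  then show ?thesis by blast
qed

end
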